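(* Let $\Gamma\curvearrowright(X,\mu)$ be an essentially free probability measure preserving action of a countable discrete group $\Gamma$ on a standard probability space. Then $\Gamma$ is properly proximal if and only if the transformation groupoid $\Gamma\ltimes X$ is properly proximal.
   Context: **Groups.** A countable discrete group $\Gamma$ is properly proximal if there is no left $\Gamma$-invariant state on $\mathbb S(\Gamma)=\{f\in\ell^\infty(\Gamma): f-R_tf\in c_0(\Gamma)\text{ for all }t\in\Gamma\}$, where $(R_tf)(s)=f(st)$. **Transformation groupoid.** $\Gamma\ltimes X$ is the groupoid $\Gamma\times X$ with unit space $\{e\}\times X\cong X$, $s(g,x)=x$, $r(g,x)=gx$, $(g,hx)(h,x)=(gh,x)$, $(g,x)^{-1}=(g^{-1},gx)$. Essentially free: almost every point of $X$ has trivial stabilizer. **Countable p.m.p. groupoids.** Borel spaces are standard; sets and maps are considered modulo null sets. A countable p.m.p. groupoid $(\mathcal G,\nu)$ with unit space $(\mathcal G^{(0)},\mu)$ is a Borel groupoid with countable-to-one Borel source and range maps $s,r:\mathcal G\to\mathcal G^{(0)}$ (Borel multiplication and inversion) and a probability measure $\mu$ on $\mathcal G^{(0)}$ such that $\nu(C):=\int|r^{-1}(x)\cap C|\,d\mu(x)=\int|s^{-1}(x)\cap C|\,d\mu(x)$ for all Borel $C\subset\mathcal G$. For $B\subset\mathcal G^{(0)}$ put $\mathcal G^B=r^{-1}(B)$, $\mathcal G_B=s^{-1}(B)$. A local bisection is a Borel set $\theta\subset\mathcal G$ on which $s$ and $r$ are injective, with source set $s(\theta)$ and range set $r(\theta)$;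 $[[\mathcal G]]$ is the set of local bisections. For $x\in r(\theta)$, $r_\theta^{-1}(x)$ is the unique arrow of $\theta$ with range $x$. For $f\in L^\infty(\mathcal G,\nu)$, $(L_\theta f)(\gamma)=f([r_\theta^{-1}(r(\gamma))]^{-1}\gamma)$ if $r(\gamma)\in r(\theta)$ and $0$ otherwise; $(R_\theta f)(\gamma)=f(\gamma\, r_\theta^{-1}(s(\gamma)))$ if $s(\gamma)\in r(\theta)$ and $0$ otherwise. **Proper proximality of groupoids.** $c_0(\mathcal G)$ is the set of $f\in L^\infty(\mathcal G,\nu)$ such that for every $\varepsilon>0$ there are measurable $B,B'\subset\mathcal G^{(0)}$ with $\mu(B),\mu(B')<\varepsilon$ and $F\subset\mathcal G$ with $\nu(F)<\infty$ such that $\|(1-\chi_{\mathcal G^B})(1-\chi_{\mathcal G_{B'}})f(1-\chi_F)\|_\infty\le\varepsilon$. $\mathbb S(\mathcal G)$ is the $C^*$-algebra of $f\in L^\infty(\mathcal G,\nu)$ with $f\chi_{\mathcal G_{r(\theta)}}-R_\theta f\in c_0(\mathcal G)$ for all $\theta\in[[\mathcal G]]$; it contains $L^\infty(\mathcal G^{(0)})$ via $f\mapsto f\circ r$. $\mathcal G$ is properly proximal if there is no state $\varphi$ on $\mathbb S(\mathcal G)$ that is left $[[\mathcal G]]$-invariant (i.e. $\varphi(f\chi_{\mathcal G^{s(\theta)}}-L_\theta f)=0$ for all $f\in\mathbb S(\mathcal G)$, $\theta\in[[\mathcal G]]$) and whose restriction to $L^\infty(\mathcal G^{(0)})$ is normal.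 *)

theory Defs
  imports "HOL-Probability.Probability" "HOL-Algebra.Algebra"
begin

section \<open>Bounded functions, states and normality\<close>

text \<open>Elements of \<open>L\<^sup>\<infinity>(M)\<close> are represented by measurable, essentially bounded functions, and every
  condition imposed on them below is an almost-everywhere condition. For a counting measure,
  \<open>L\<^sup>\<infinity>\<close> is \<open>\<ell>\<^sup>\<infinity>\<close> of the underlying set.\<close>

definition Linfty :: "'a measure \<Rightarrow> ('a \<Rightarrow> 'b::real_normed_vector) set" where
  "Linfty M = {f \<in> borel_measurable M. \<exists>C. AE x in M. norm (f x) \<le> C}"

text \<open>States on a unital self-adjoint subspace \<open>A\<close> of \<open>L\<^sup>\<infinity>(M)\<close>. Linearity and positivity force the
  value at a representative to depend only on its almost-everywhere class; the values of the
  functional outside \<open>A\<close> are irrelevant.\<close>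

definition state_on :: "'a measure \<Rightarrow> ('a \<Rightarrow> complex) set \<Rightarrow> (('a \<Rightarrow> complex) \<Rightarrow> complex) \<Rightarrow> bool" where
  "state_on M A \<phi> \<longleftrightarrow>
     (\<forall>f\<in>A. \<forall>g\<in>A. \<phi> (\<lambda>x. f x + g x) = \<phi> f + \<phi> g) \<and>
     (\<forall>c. \<forall>f\<in>A. \<phi> (\<lambda>x. c * f x) = c * \<phi> f) \<and>
     (\<forall>f\<in>A. (AE x in M. f x \<in> \<real>\<^sub>\<ge>\<^sub>0) \<longrightarrow> \<phi> f \<in> \<real>\<^sub>\<ge>\<^sub>0) \<and>
     \<phi> (\<lambda>x. 1) = 1"

text \<open>Supremum of a set of self-adjoint elements in the order of \<open>L\<^sup>\<infinity>(M)\<close>; for an uncountable set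
  this differs from the pointwise supremum.\<close>

definition Linfty_lub :: "'a measure \<Rightarrow> ('a \<Rightarrow> real) set \<Rightarrow> ('a \<Rightarrow> real) \<Rightarrow> bool" where
  "Linfty_lub M D F \<longleftrightarrow> F \<in> Linfty M \<and>
     (\<forall>f\<in>D. AE x in M. f x \<le> F x) \<and>
     (\<forall>H\<in>Linfty M. (\<forall>f\<in>D. AE x in M. f x \<le> H x) \<longrightarrow> (AE x in M. F x \<le> H x))"

text \<open>Normality: \<open>\<psi>\<close> converges to \<open>\<psi> F\<close> along every bounded increasing net of self-adjoint elements
  with supremum \<open>F\<close>. Such a net is given as an upward directed set indexed by itself.\<close>

definition normal_functional :: "'a measure \<Rightarrow> (('a \<Rightarrow> complex) \<Rightarrow> complex) \<Rightarrow> bool" where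
  "normal_functional M \<psi> \<longleftrightarrow>
     (\<forall>D F. D \<noteq> {} \<longrightarrow> D \<subseteq> Linfty M \<longrightarrow>
        (\<forall>f\<in>D. \<forall>g\<in>D. \<exists>h\<in>D. (AE x in M. f x \<le> h x) \<and> (AE x in M. g x \<le> h x)) \<longrightarrow>
        Linfty_lub M D F \<longrightarrow>
        (\<forall>\<epsilon>>0. \<exists>f\<in>D. \<forall>g\<in>D. (AE x in M. f x \<le> g x) \<longrightarrow>
            norm (\<psi> (\<lambda>x. complex_of_real (g x)) - \<psi> (\<lambda>x. complex_of_real (F x))) < \<epsilon>))"


section \<open>Properly proximal groups\<close>

definition group_c0 :: "('g, 'm) monoid_scheme \<Rightarrow> ('g \<Rightarrow> complex) set" where
  "group_c0 G = {f. \<forall>\<epsilon>>0. finite {s \<in> carrier G. norm (f s) \<ge> \<epsilon>}}"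

definition group_S :: "('g, 'm) monoid_scheme \<Rightarrow> ('g \<Rightarrow> complex) set" where
  "group_S G = {f \<in> Linfty (count_space (carrier G)).
     \<forall>t\<in>carrier G. (\<lambda>s. f s - f (s \<otimes>\<^bsub>G\<^esub> t)) \<in> group_c0 G}"

definition properly_proximal_group :: "('g, 'm) monoid_scheme \<Rightarrow> bool" where
  "properly_proximal_group G \<longleftrightarrow>
     \<not> (\<exists>\<phi>. state_on (count_space (carrier G)) (group_S G) \<phi> \<and>
          (\<forall>t\<in>carrier G. \<forall>f\<in>group_S G. \<phi> (\<lambda>s. f (inv\<^bsub>G\<^esub> t \<otimes>\<^bsub>G\<^esub> s)) = \<phi> f))"


section \<open>Countable p.m.p. groupoids\<close>

definition standard_borel :: "'a measure \<Rightarrow> bool" where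
  "standard_borel M \<longleftrightarrow>
     (\<exists>T. completely_metrizable_space T \<and> second_countable T \<and> topspace T = space M \<and>
          sets M = sigma_sets (space M) {U. openin T U})"

text \<open>The unit space is a separate sort, embedded into the arrows by \<open>ident\<close>. The field \<open>arrows\<close>
  only carries the Borel space of arrows: its measure values are never used, the measure on the
  arrows being the one induced by the measure on \<open>units\<close>.\<close>

record ('a, 'x) groupoid =
  arrows :: "'a measure"
  units :: "'x measure"
  src :: "'a \<Rightarrow> 'x"
  rng :: "'a \<Rightarrow> 'x"
  compose_arrows :: "'a \<Rightarrow> 'a \<Rightarrow> 'a"
  inverse_arrow :: "'a \<Rightarrow> 'a"
  ident :: "'x \<Rightarrow> 'a"

definition composable :: "('a, 'x) groupoid \<Rightarrow> ('a \<times> 'a) set" where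
  "composable \<G> = {(\<gamma>, \<delta>). \<gamma> \<in> space (arrows \<G>) \<and> \<delta> \<in> space (arrows \<G>) \<and> src \<G> \<gamma> = rng \<G> \<delta>}"

locale countable_pmp_groupoid =
  fixes \<G> :: "('a, 'x) groupoid"
  assumes src_closed: "\<gamma> \<in> space (arrows \<G>) \<Longrightarrow> src \<G> \<gamma> \<in> space (units \<G>)"
    and rng_closed: "\<gamma> \<in> space (arrows \<G>) \<Longrightarrow> rng \<G> \<gamma> \<in> space (units \<G>)"
    and ident_closed: "x \<in> space (units \<G>) \<Longrightarrow> ident \<G> x \<in> space (arrows \<G>)"
    and src_ident: "x \<in> space (units \<G>) \<Longrightarrow> src \<G> (ident \<G> x) = x"
    and rng_ident: "x \<in> space (units \<G>) \<Longrightarrow> rng \<G> (ident \<G> x) = x"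
    and comp_closed: "(\<gamma>, \<delta>) \<in> composable \<G> \<Longrightarrow> compose_arrows \<G> \<gamma> \<delta> \<in> space (arrows \<G>)"
    and src_comp: "(\<gamma>, \<delta>) \<in> composable \<G> \<Longrightarrow> src \<G> (compose_arrows \<G> \<gamma> \<delta>) = src \<G> \<delta>"
    and rng_comp: "(\<gamma>, \<delta>) \<in> composable \<G> \<Longrightarrow> rng \<G> (compose_arrows \<G> \<gamma> \<delta>) = rng \<G> \<gamma>"
    and comp_assoc: "(\<gamma>, \<delta>) \<in> composable \<G> \<Longrightarrow> (\<delta>, \<eta>) \<in> composable \<G> \<Longrightarrow>
           compose_arrows \<G> (compose_arrows \<G> \<gamma> \<delta>) \<eta> = compose_arrows \<G> \<gamma> (compose_arrows \<G> \<delta> \<eta>)"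
    and ident_left: "\<gamma> \<in> space (arrows \<G>) \<Longrightarrow> compose_arrows \<G> (ident \<G> (rng \<G> \<gamma>)) \<gamma> = \<gamma>"
    and ident_right: "\<gamma> \<in> space (arrows \<G>) \<Longrightarrow> compose_arrows \<G> \<gamma> (ident \<G> (src \<G> \<gamma>)) = \<gamma>"
    and inverse_closed: "\<gamma> \<in> space (arrows \<G>) \<Longrightarrow> inverse_arrow \<G> \<gamma> \<in> space (arrows \<G>)"
    and src_inverse: "\<gamma> \<in> space (arrows \<G>) \<Longrightarrow> src \<G> (inverse_arrow \<G> \<gamma>) = rng \<G> \<gamma>"
    and rng_inverse: "\<gamma> \<in> space (arrows \<G>) \<Longrightarrow> rng \<G> (inverse_arrow \<G> \<gamma>) = src \<G> \<gamma>"
    and inverse_left: "\<gamma> \<in> space (arrows \<G>) \<Longrightarrow> compose_arrows \<G> (inverse_arrow \<G> \<gamma>) \<gamma> = ident \<G> (src \<G> \<gamma>)"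
    and inverse_right: "\<gamma> \<in> space (arrows \<G>) \<Longrightarrow> compose_arrows \<G> \<gamma> (inverse_arrow \<G> \<gamma>) = ident \<G> (rng \<G> \<gamma>)"
    and standard_arrows: "standard_borel (arrows \<G>)"
    and standard_units: "standard_borel (units \<G>)"
    and src_measurable: "src \<G> \<in> measurable (arrows \<G>) (units \<G>)"
    and rng_measurable: "rng \<G> \<in> measurable (arrows \<G>) (units \<G>)"
    and ident_measurable: "ident \<G> \<in> measurable (units \<G>) (arrows \<G>)"
    and inverse_measurable: "inverse_arrow \<G> \<in> measurable (arrows \<G>) (arrows \<G>)"
    and comp_measurable: "(\<lambda>(\<gamma>, \<delta>). compose_arrows \<G> \<gamma> \<delta>) \<in>
           measurable (restrict_space (arrows \<G> \<Otimes>\<^sub>M arrows \<G>) (composable \<G>)) (arrows \<G>)"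
    and prob_units: "prob_space (units \<G>)"
    and countable_src: "x \<in> space (units \<G>) \<Longrightarrow> countable {\<gamma> \<in> space (arrows \<G>). src \<G> \<gamma> = x}"
    and countable_rng: "x \<in> space (units \<G>) \<Longrightarrow> countable {\<gamma> \<in> space (arrows \<G>). rng \<G> \<gamma> = x}"
    and pmp: "C \<in> sets (arrows \<G>) \<Longrightarrow>
           (\<integral>\<^sup>+x. emeasure (count_space UNIV) {\<gamma> \<in> C. rng \<G> \<gamma> = x} \<partial>units \<G>) =
           (\<integral>\<^sup>+x. emeasure (count_space UNIV) {\<gamma> \<in> C. src \<G> \<gamma> = x} \<partial>units \<G>)"

text \<open>The measure \<open>\<nu>\<close> on the arrows.\<close>

definition arrow_measure :: "('a, 'x) groupoid \<Rightarrow> 'a measure" where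
  "arrow_measure \<G> = measure_of (space (arrows \<G>)) (sets (arrows \<G>))
     (\<lambda>C. \<integral>\<^sup>+x. emeasure (count_space UNIV) {\<gamma> \<in> C. rng \<G> \<gamma> = x} \<partial>units \<G>)"

definition local_bisections :: "('a, 'x) groupoid \<Rightarrow> 'a set set" where
  "local_bisections \<G> = {\<theta> \<in> sets (arrows \<G>). inj_on (src \<G>) \<theta> \<and> inj_on (rng \<G>) \<theta>}"

definition arrow_with_rng :: "('a, 'x) groupoid \<Rightarrow> 'a set \<Rightarrow> 'x \<Rightarrow> 'a" where
  "arrow_with_rng \<G> \<theta> x = the_inv_into \<theta> (rng \<G>) x"

definition left_translate :: "('a, 'x) groupoid \<Rightarrow> 'a set \<Rightarrow> ('a \<Rightarrow> complex) \<Rightarrow> 'a \<Rightarrow> complex" where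
  "left_translate \<G> \<theta> f \<gamma> =
     (if rng \<G> \<gamma> \<in> rng \<G> ` \<theta>
      then f (compose_arrows \<G> (inverse_arrow \<G> (arrow_with_rng \<G> \<theta> (rng \<G> \<gamma>))) \<gamma>) else 0)"

definition right_translate :: "('a, 'x) groupoid \<Rightarrow> 'a set \<Rightarrow> ('a \<Rightarrow> complex) \<Rightarrow> 'a \<Rightarrow> complex" where
  "right_translate \<G> \<theta> f \<gamma> =
     (if src \<G> \<gamma> \<in> rng \<G> ` \<theta>
      then f (compose_arrows \<G> \<gamma> (arrow_with_rng \<G> \<theta> (src \<G> \<gamma>))) else 0)"


section \<open>Properly proximal groupoids\<close>

definition groupoid_c0 :: "('a, 'x) groupoid \<Rightarrow> ('a \<Rightarrow> complex) set" where
  "groupoid_c0 \<G> = {f \<in> Linfty (arrow_measure \<G>). \<forall>\<epsilon>>0.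
     \<exists>B\<in>sets (units \<G>). \<exists>B'\<in>sets (units \<G>). \<exists>F\<in>sets (arrow_measure \<G>).
       emeasure (units \<G>) B < ennreal \<epsilon> \<and> emeasure (units \<G>) B' < ennreal \<epsilon> \<and>
       emeasure (arrow_measure \<G>) F < \<infinity> \<and>
       (AE \<gamma> in arrow_measure \<G>.
          norm ((1 - indicator (rng \<G> -` B) \<gamma>) * (1 - indicator (src \<G> -` B') \<gamma>) * f \<gamma> *
                (1 - indicator F \<gamma>)) \<le> \<epsilon>)}"

definition groupoid_S :: "('a, 'x) groupoid \<Rightarrow> ('a \<Rightarrow> complex) set" where
  "groupoid_S \<G> = {f \<in> Linfty (arrow_measure \<G>). \<forall>\<theta>\<in>local_bisections \<G>.
     (\<lambda>\<gamma>. f \<gamma> * indicator (src \<G> -` (rng \<G> ` \<theta>)) \<gamma> - right_translate \<G> \<theta> f \<gamma>) \<in> groupoid_c0 \<G>}"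

definition left_invariant_state :: "('a, 'x) groupoid \<Rightarrow> (('a \<Rightarrow> complex) \<Rightarrow> complex) \<Rightarrow> bool" where
  "left_invariant_state \<G> \<phi> \<longleftrightarrow>
     state_on (arrow_measure \<G>) (groupoid_S \<G>) \<phi> \<and>
     (\<forall>f\<in>groupoid_S \<G>. \<forall>\<theta>\<in>local_bisections \<G>.
        \<phi> (\<lambda>\<gamma>. f \<gamma> * indicator (rng \<G> -` (src \<G> ` \<theta>)) \<gamma> - left_translate \<G> \<theta> f \<gamma>) = 0)"

definition properly_proximal_groupoid :: "('a, 'x) groupoid \<Rightarrow> bool" where
  "properly_proximal_groupoid \<G> \<longleftrightarrow>
     \<not> (\<exists>\<phi>. left_invariant_state \<G> \<phi> \<and>
            normal_functional (units \<G>) (\<lambda>f. \<phi> (\<lambda>\<gamma>. f (rng \<G> \<gamma>))))"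


section \<open>Transformation groupoids\<close>

definition pmp_action :: "('g, 'm) monoid_scheme \<Rightarrow> 'x measure \<Rightarrow> ('g \<Rightarrow> 'x \<Rightarrow> 'x) \<Rightarrow> bool" where
  "pmp_action G M \<alpha> \<longleftrightarrow> group_action G (space M) \<alpha> \<and>
     (\<forall>g\<in>carrier G. \<alpha> g \<in> measurable M M \<and> distr M M (\<alpha> g) = M)"

definition essentially_free :: "('g, 'm) monoid_scheme \<Rightarrow> 'x measure \<Rightarrow> ('g \<Rightarrow> 'x \<Rightarrow> 'x) \<Rightarrow> bool" where
  "essentially_free G M \<alpha> \<longleftrightarrow> (AE x in M. stabilizer G \<alpha> x = {\<one>\<^bsub>G\<^esub>})"

definition transformation_groupoid ::
  "('g, 'm) monoid_scheme \<Rightarrow> 'x measure \<Rightarrow> ('g \<Rightarrow> 'x \<Rightarrow> 'x) \<Rightarrow> ('g \<times> 'x, 'x) groupoid" where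
  "transformation_groupoid G M \<alpha> =
     \<lparr>arrows = count_space (carrier G) \<Otimes>\<^sub>M M,
      units = M,
      src = (\<lambda>(g, x). x),
      rng = (\<lambda>(g, x). \<alpha> g x),
      compose_arrows = (\<lambda>(g, y) (h, x). (g \<otimes>\<^bsub>G\<^esub> h, x)),
      inverse_arrow = (\<lambda>(g, x). (inv\<^bsub>G\<^esub> g, \<alpha> g x)),
      ident = (\<lambda>x. (\<one>\<^bsub>G\<^esub>, x))\<rparr>"


text \<open>The transformation groupoid of a p.m.p. action is a countable p.m.p. groupoid, and its measure
  is the product of the counting measure with the measure of the space.\<close>

lemma standard_borel_pair:
  assumes "standard_borel M" "standard_borel N"
  shows "standard_borel (M \<Otimes>\<^sub>M N)"
proof -
  obtain S where S: "completely_metrizable_space S" "second_countable S" "topspace S = space M"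
      "sets M = sigma_sets (space M) {U. openin S U}"
    using assms(1) unfolding standard_borel_def by blast
  obtain T where T: "completely_metrizable_space T" "second_countable T" "topspace T = space N"
      "sets N = sigma_sets (space N) {U. openin T U}"
    using assms(2) unfolding standard_borel_def by blast
  let ?P = "prod_topology S T"
  let ?Z = "space M \<times> space N"
  obtain A where A: "countable A" "\<And>V. V \<in> A \<Longrightarrow> openin S V"
      "\<And>U x. openin S U \<Longrightarrow> x \<in> U \<Longrightarrow> \<exists>V\<in>A. x \<in> V \<and> V \<subseteq> U"
    using S(2) unfolding second_countable_def by metis
  obtain B where B: "countable B" "\<And>V. V \<in> B \<Longrightarrow> openin T V"
      "\<And>U x. openin T U \<Longrightarrow> x \<in> U \<Longrightarrow> \<exists>V\<in>B. x \<in> V \<and> V \<subseteq> U"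
    using T(2) unfolding second_countable_def by metis
  define R where "R = (\<lambda>(V, W). V \<times> W) ` (A \<times> B)"
  have R_countable: "countable R"
    unfolding R_def using A(1) B(1) by (intro countable_image countable_SIGMA)
  have R_open: "openin ?P V" if "V \<in> R" for V
    using that A(2) B(2) by (auto simp: R_def openin_prod_Times_iff)
  have R_base: "\<exists>V\<in>R. x \<in> V \<and> V \<subseteq> U" if U: "openin ?P U" "x \<in> U" for U x
  proof -
    obtain a b where x: "x = (a, b)" by (cases x)
    have "\<exists>V W. openin S V \<and> openin T W \<and> a \<in> V \<and> b \<in> W \<and> V \<times> W \<subseteq> U"
      using iffD1[OF openin_prod_topology_alt U(1), rule_format] U(2) unfolding x by fast
    then obtain V W where VW: "openin S V" "openin T W" "a \<in> V" "b \<in> W" "V \<times> W \<subseteq> U"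
      by (elim exE conjE)
    obtain V' where V': "V' \<in> A" "a \<in> V'" "V' \<subseteq> V"
      using A(3)[OF VW(1,3)] by (elim bexE conjE)
    obtain W' where W': "W' \<in> B" "b \<in> W'" "W' \<subseteq> W"
      using B(3)[OF VW(2,4)] by (elim bexE conjE)
    have "V' \<times> W' \<in> R"
      using V'(1) W'(1) by (auto simp: R_def)
    moreover have "x \<in> V' \<times> W'" "V' \<times> W' \<subseteq> U"
      using V' W' VW(5) x by auto
    ultimately show ?thesis
      by (intro bexI[of _ "V' \<times> W'"] conjI)
  qed
  have sc: "second_countable ?P"
    unfolding second_countable_def
    by (intro exI[of _ R] conjI ballI allI impI; (elim conjE)?)
      (fact R_countable, erule R_open, rule R_base)
  have cm: "completely_metrizable_space ?P"
    by (simp add: completely_metrizable_space_prod_topology S(1) T(1))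
  have sp: "topspace ?P = space (M \<Otimes>\<^sub>M N)"
    by (simp add: S(3) T(3) space_pair_measure)
  have Mo: "V \<in> sets M" if "openin S V" for V
    using that S(4) by auto
  have No: "V \<in> sets N" if "openin T V" for V
    using that T(4) by auto
  have open_meas: "U \<in> sets (M \<Otimes>\<^sub>M N)" if U: "openin ?P U" for U
  proof -
    have "U = \<Union>{V \<in> R. V \<subseteq> U}"
      using R_base[OF U] by blast
    moreover have "\<Union>{V \<in> R. V \<subseteq> U} \<in> sets (M \<Otimes>\<^sub>M N)"
      using R_countable A(2) B(2) Mo No
      by (intro sets.countable_Union) (auto simp: R_def intro: countable_subset)
    ultimately show ?thesis by simp
  qed
  let ?Q = "sigma ?Z {U. openin ?P U}"
  have sub: "{U. openin ?P U} \<subseteq> Pow ?Z"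
    using openin_subset[of ?P] S(3) T(3) by auto
  have Q: "space ?Q = ?Z" "sets ?Q = sigma_sets ?Z {U. openin ?P U}"
    using sub by auto
  have fst: "fst \<in> measurable ?Q M"
  proof (rule measurable_sigma_sets[OF S(4)])
    show "{U. openin S U} \<subseteq> Pow (space M)" using openin_subset[of S] S(3) by auto
    show "fst \<in> space ?Q \<rightarrow> space M" using Q by auto
    fix V assume V: "V \<in> {U. openin S U}"
    then have "V \<subseteq> space M" using openin_subset S(3) by fastforce
    then have "fst -` V \<inter> space ?Q = V \<times> space N" using Q by auto
    moreover have "openin ?P (V \<times> space N)"
      using V T(3) by (metis mem_Collect_eq openin_prod_Times_iff openin_topspace)
    ultimately show "fst -` V \<inter> space ?Q \<in> sets ?Q" using Q by auto
  qed
  have snd: "snd \<in> measurable ?Q N"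
  proof (rule measurable_sigma_sets[OF T(4)])
    show "{U. openin T U} \<subseteq> Pow (space N)" using openin_subset[of T] T(3) by auto
    show "snd \<in> space ?Q \<rightarrow> space N" using Q by auto
    fix V assume V: "V \<in> {U. openin T U}"
    then have "V \<subseteq> space N" using openin_subset T(3) by fastforce
    then have "snd -` V \<inter> space ?Q = space M \<times> V" using Q by auto
    moreover have "openin ?P (space M \<times> V)"
      using V S(3) by (metis mem_Collect_eq openin_prod_Times_iff openin_topspace)
    ultimately show "snd -` V \<inter> space ?Q \<in> sets ?Q" using Q by auto
  qed
  have id: "(\<lambda>x. (fst x, snd x)) \<in> measurable ?Q (M \<Otimes>\<^sub>M N)"
    using fst snd by (rule measurable_Pair)
  have "sets (M \<Otimes>\<^sub>M N) \<subseteq> sets ?Q"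
  proof
    fix C assume C: "C \<in> sets (M \<Otimes>\<^sub>M N)"
    then have "C \<subseteq> ?Z" using sets.sets_into_space space_pair_measure by metis
    then have "(\<lambda>x. (fst x, snd x)) -` C \<inter> space ?Q = C" using Q by auto
    then show "C \<in> sets ?Q" using measurable_sets[OF id C] by simp
  qed
  moreover have "sigma_sets (space (M \<Otimes>\<^sub>M N)) {U. openin ?P U} \<subseteq> sets (M \<Otimes>\<^sub>M N)"
    using open_meas by (intro sets.sigma_sets_subset) auto
  then have "sets ?Q \<subseteq> sets (M \<Otimes>\<^sub>M N)"
    unfolding Q(2) by (simp only: space_pair_measure)
  ultimately have "sets (M \<Otimes>\<^sub>M N) = sigma_sets (space (M \<Otimes>\<^sub>M N)) {U. openin ?P U}"
    using Q(2) by (simp add: space_pair_measure)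
  then show ?thesis
    unfolding standard_borel_def using sc cm sp by blast
qed

lemma standard_borel_count_space:
  assumes "countable A"
  shows "standard_borel (count_space A)"
proof -
  have "Pow A = sigma_sets A (Pow A)"
    using sigma_algebra.sigma_sets_eq[OF sigma_algebra_Pow] by metis
  moreover have "{U. openin (discrete_topology A) U} = Pow A"
    by auto
  ultimately have "sets (count_space A) = sigma_sets (space (count_space A)) {U. openin (discrete_topology A) U}"
    by simp
  then show ?thesis
    unfolding standard_borel_def
    by (intro exI[of _ "discrete_topology A"] conjI)
      (simp_all only: completely_metrizable_space_discrete_topology second_countable_discrete_topology
        assms topspace_discrete_topology space_count_space)
qed

lemma emeasure_count_space_inj_image:
  assumes "inj_on f A"
  shows "emeasure (count_space UNIV) (f ` A) = emeasure (count_space UNIV) A"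
  using assms by (cases "finite A") (auto simp: card_image finite_image_iff)

lemma transformation_groupoid_fibres:
  fixes G (structure)
  assumes G: "countable (carrier G)" and M: "prob_space M" and act: "pmp_action G M \<alpha>"
    and C: "C \<in> sets (count_space (carrier G) \<Otimes>\<^sub>M M)"
  shows "(\<integral>\<^sup>+x. emeasure (count_space UNIV) {\<gamma> \<in> C. (case \<gamma> of (g, x) \<Rightarrow> x) = x} \<partial>M) =
           emeasure (count_space (carrier G) \<Otimes>\<^sub>M M) C"
    and "(\<integral>\<^sup>+x. emeasure (count_space UNIV) {\<gamma> \<in> C. (case \<gamma> of (g, x) \<Rightarrow> \<alpha> g x) = x} \<partial>M) =
           emeasure (count_space (carrier G) \<Otimes>\<^sub>M M) C"
proof -
  interpret M: prob_space M by fact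
  interpret K: sigma_finite_measure "count_space (carrier G)"
    using G by (rule sigma_finite_measure_count_space_countable)
  interpret P: pair_sigma_finite "count_space (carrier G)" M ..
  interpret A: group_action G "space M" \<alpha>
    using act unfolding pmp_action_def by blast
  interpret group G
    using A.group_hom unfolding group_hom_def by blast
  have C_sub: "C \<subseteq> carrier G \<times> space M"
    using sets.sets_into_space[OF C] by (simp add: space_pair_measure)
  have count: "emeasure (count_space UNIV) {g \<in> carrier G. (g, f g) \<in> C} =
      (\<integral>\<^sup>+g. indicator C (g, f g) \<partial>count_space (carrier G))" for f :: "'a \<Rightarrow> 'c"
  proof -
    have "(\<integral>\<^sup>+g. indicator C (g, f g) \<partial>count_space (carrier G)) =
        (\<integral>\<^sup>+g. indicator {g \<in> carrier G. (g, f g) \<in> C} g \<partial>count_space (carrier G))"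
      by (intro nn_integral_cong) (auto simp: indicator_def)
    also have "\<dots> = emeasure (count_space (carrier G)) {g \<in> carrier G. (g, f g) \<in> C}"
      by (intro nn_integral_indicator) auto
    also have "\<dots> = emeasure (count_space UNIV) {g \<in> carrier G. (g, f g) \<in> C}"
      by (cases "finite {g \<in> carrier G. (g, f g) \<in> C}") (auto simp: emeasure_count_space)
    finally show ?thesis by simp
  qed
  have total: "(\<integral>\<^sup>+g. (\<integral>\<^sup>+x. indicator C (g, x) \<partial>M) \<partial>count_space (carrier G)) =
      emeasure (count_space (carrier G) \<Otimes>\<^sub>M M) C"
    using C by (subst M.nn_integral_fst) auto
  have s: "emeasure (count_space UNIV) {\<gamma> \<in> C. (case \<gamma> of (g, x) \<Rightarrow> x) = x} =
      (\<integral>\<^sup>+g. indicator C (g, x) \<partial>count_space (carrier G))" for x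
  proof -
    have "{\<gamma> \<in> C. (case \<gamma> of (g, x) \<Rightarrow> x) = x} = (\<lambda>g. (g, x)) ` {g \<in> carrier G. (g, x) \<in> C}"
      using C_sub by auto
    then show ?thesis
      using count[of "\<lambda>_. x"] by (simp add: emeasure_count_space_inj_image inj_on_def)
  qed
  show "(\<integral>\<^sup>+x. emeasure (count_space UNIV) {\<gamma> \<in> C. (case \<gamma> of (g, x) \<Rightarrow> x) = x} \<partial>M) =
      emeasure (count_space (carrier G) \<Otimes>\<^sub>M M) C"
    unfolding s total[symmetric]
    by (rule P.Fubini'[of "\<lambda>g x. indicator C (g, x)"]) (use C in simp)
  have act_inv: "\<alpha> (inv g) (\<alpha> g x) = x" "\<alpha> g (\<alpha> (inv g) x) = x" "\<alpha> g x \<in> space M"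
    if "g \<in> carrier G" "x \<in> space M" for g x
    using that A.orbit_sym_aux A.element_image by (metis inv_closed inv_inv)+
  have r: "emeasure (count_space UNIV) {\<gamma> \<in> C. (case \<gamma> of (g, x) \<Rightarrow> \<alpha> g x) = x} =
      (\<integral>\<^sup>+g. indicator C (g, \<alpha> (inv g) x) \<partial>count_space (carrier G))" if x: "x \<in> space M" for x
  proof -
    have "{\<gamma> \<in> C. (case \<gamma> of (g, x) \<Rightarrow> \<alpha> g x) = x} =
        (\<lambda>g. (g, \<alpha> (inv g) x)) ` {g \<in> carrier G. (g, \<alpha> (inv g) x) \<in> C}"
      using C_sub x act_inv by (auto simp: image_iff)
    then show ?thesis
      using count[of "\<lambda>g. \<alpha> (inv g) x"] by (simp add: emeasure_count_space_inj_image inj_on_def)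
  qed
  have meas: "\<alpha> g \<in> measurable M M" "distr M M (\<alpha> g) = M" if "g \<in> carrier G" for g
    using act that unfolding pmp_action_def by auto
  have "(\<integral>\<^sup>+x. emeasure (count_space UNIV) {\<gamma> \<in> C. (case \<gamma> of (g, x) \<Rightarrow> \<alpha> g x) = x} \<partial>M) =
      (\<integral>\<^sup>+x. (\<integral>\<^sup>+g. indicator C (g, \<alpha> (inv g) x) \<partial>count_space (carrier G)) \<partial>M)"
    by (intro nn_integral_cong r)
  also have "\<dots> = (\<integral>\<^sup>+g. (\<integral>\<^sup>+x. indicator C (g, \<alpha> (inv g) x) \<partial>M) \<partial>count_space (carrier G))"
  proof (rule P.Fubini'[of "\<lambda>g x. indicator C (g, \<alpha> (inv g) x)"])
    have "(\<lambda>(g, x). (g, \<alpha> (inv g) x)) \<in>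
        measurable (count_space (carrier G) \<Otimes>\<^sub>M M) (count_space (carrier G) \<Otimes>\<^sub>M M)"
      using meas by (intro measurable_pair_measure_countable1[OF G]) simp
    from measurable_compose[OF this borel_measurable_indicator[OF C]]
    show "(\<lambda>(g, x). indicator C (g, \<alpha> (inv g) x) :: ennreal) \<in>
        borel_measurable (count_space (carrier G) \<Otimes>\<^sub>M M)"
      by (simp add: case_prod_beta')
  qed
  also have "\<dots> = (\<integral>\<^sup>+g. (\<integral>\<^sup>+x. indicator C (g, x) \<partial>M) \<partial>count_space (carrier G))"
  proof (rule nn_integral_cong)
    fix g assume "g \<in> space (count_space (carrier G))"
    then have g: "g \<in> carrier G" by simp
    then have "(\<integral>\<^sup>+x. indicator C (g, x) \<partial>M) = (\<integral>\<^sup>+x. indicator C (g, x) \<partial>distr M M (\<alpha> (inv g)))"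
      by (simp add: meas)
    also have "\<dots> = (\<integral>\<^sup>+x. indicator C (g, \<alpha> (inv g) x) \<partial>M)"
    proof (rule nn_integral_distr)
      show "\<alpha> (inv g) \<in> measurable M M"
        using g by (simp add: meas)
      show "(\<lambda>x. indicator C (g, x) :: ennreal) \<in> borel_measurable (distr M M (\<alpha> (inv g)))"
        using measurable_compose[OF measurable_Pair1'[of g "count_space (carrier G)" M]
            borel_measurable_indicator[OF C]] g by simp
    qed
    finally show "(\<integral>\<^sup>+x. indicator C (g, \<alpha> (inv g) x) \<partial>M) = (\<integral>\<^sup>+x. indicator C (g, x) \<partial>M)" by simp
  qed
  finally show "(\<integral>\<^sup>+x. emeasure (count_space UNIV) {\<gamma> \<in> C. (case \<gamma> of (g, x) \<Rightarrow> \<alpha> g x) = x} \<partial>M) =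
      emeasure (count_space (carrier G) \<Otimes>\<^sub>M M) C"
    using total by simp
qed

lemma arrow_measure_transformation_groupoid:
  assumes "countable (carrier G)" "prob_space M" "pmp_action G M \<alpha>"
  shows "arrow_measure (transformation_groupoid G M \<alpha>) = count_space (carrier G) \<Otimes>\<^sub>M M"
proof -
  let ?P = "count_space (carrier G) \<Otimes>\<^sub>M M"
  have "arrow_measure (transformation_groupoid G M \<alpha>) = measure_of (space ?P) (sets ?P) (emeasure ?P)"
    unfolding arrow_measure_def transformation_groupoid_def groupoid.simps
    using transformation_groupoid_fibres(2)[OF assms] sets.space_closed[of ?P]
    by (intro measure_of_eq) (auto simp: sets.sigma_sets_eq)
  then show ?thesis
    by (simp add: measure_of_of_measure)
qed

lemma countable_pmp_transformation_groupoid: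
  fixes G (structure)
  assumes G: "countable (carrier G)" and M: "prob_space M" "standard_borel M"
    and act: "pmp_action G M \<alpha>"
  shows "countable_pmp_groupoid (transformation_groupoid G M \<alpha>)"
proof -
  interpret A: group_action G "space M" \<alpha>
    using act unfolding pmp_action_def by blast
  interpret group G
    using A.group_hom unfolding group_hom_def by blast
  have act_inv: "\<alpha> (inv g) (\<alpha> g x) = x" "\<alpha> g x \<in> space M"
    if "g \<in> carrier G" "x \<in> space M" for g x
    using that A.orbit_sym_aux A.element_image by metis+
  have act_mult: "\<alpha> (g \<otimes> h) x = \<alpha> g (\<alpha> h x)"
    if "g \<in> carrier G" "h \<in> carrier G" "x \<in> space M" for g h x
    using that A.composition_rule by metis
  have act_one: "\<alpha> \<one> x = x" if "x \<in> space M" for x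
    using that A.id_eq_one by (metis restrict_apply')
  have meas: "\<alpha> g \<in> measurable M M" if "g \<in> carrier G" for g
    using act that unfolding pmp_action_def by auto
  let ?K = "count_space (carrier G)"
  have mult_meas: "(\<lambda>p. fst (fst p) \<otimes> fst (snd p)) \<in> measurable ((?K \<Otimes>\<^sub>M M) \<Otimes>\<^sub>M (?K \<Otimes>\<^sub>M M)) ?K"
  proof -
    have "(\<lambda>(g, h). g \<otimes> h) \<in> measurable (?K \<Otimes>\<^sub>M ?K) ?K"
      by (intro measurable_pair_measure_countable1[OF G]) auto
    moreover have "(\<lambda>p. (fst (fst p), fst (snd p))) \<in> measurable ((?K \<Otimes>\<^sub>M M) \<Otimes>\<^sub>M (?K \<Otimes>\<^sub>M M)) (?K \<Otimes>\<^sub>M ?K)"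
      by measurable
    ultimately show ?thesis
      using measurable_compose by fastforce
  qed
  have comp_meas: "(\<lambda>(\<gamma>, \<delta>). (case \<gamma> of (g, y) \<Rightarrow> \<lambda>(h, x). (g \<otimes> h, x)) \<delta>) \<in>
      measurable ((?K \<Otimes>\<^sub>M M) \<Otimes>\<^sub>M (?K \<Otimes>\<^sub>M M)) (?K \<Otimes>\<^sub>M M)"
  proof -
    have "(\<lambda>p. (fst (fst p) \<otimes> fst (snd p), snd (snd p))) \<in>
        measurable ((?K \<Otimes>\<^sub>M M) \<Otimes>\<^sub>M (?K \<Otimes>\<^sub>M M)) (?K \<Otimes>\<^sub>M M)"
      using mult_meas by (intro measurable_Pair) auto
    then show ?thesis by (simp add: case_prod_beta')
  qed
  have fib: "countable {\<gamma> \<in> carrier G \<times> space M. (case \<gamma> of (g, y) \<Rightarrow> \<alpha> g y) = x}" for x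
  proof (rule countable_subset)
    show "{\<gamma> \<in> carrier G \<times> space M. (case \<gamma> of (g, y) \<Rightarrow> \<alpha> g y) = x} \<subseteq>
        (\<lambda>g. (g, \<alpha> (inv g) x)) ` carrier G"
      using act_inv by auto
    show "countable ((\<lambda>g. (g, \<alpha> (inv g) x)) ` carrier G)" using G by simp
  qed
  have fib': "countable {\<gamma> \<in> carrier G \<times> space M. (case \<gamma> of (g, y) \<Rightarrow> y) = x}" for x
    by (rule countable_subset[of _ "(\<lambda>g. (g, x)) ` carrier G"]) (use G in auto)
  show ?thesis
    unfolding transformation_groupoid_def
  proof (rule countable_pmp_groupoid.intro, unfold groupoid.simps composable_def space_pair_measure space_count_space,
      goal_cases)
    case (17) show ?case by (rule standard_borel_pair[OF standard_borel_count_space[OF G] M(2)])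
  next
    case (19) show ?case by measurable
  next
    case (20) show ?case by (intro measurable_pair_measure_countable1[OF G]) (simp add: meas)
  next
    case (21) show ?case by (intro measurable_Pair) auto
  next
    case (22) show ?case
      by (intro measurable_pair_measure_countable1[OF G]) (auto intro!: measurable_Pair simp: meas)
  next
    case (23) show ?case by (rule measurable_restrict_space1[OF comp_meas])
  next
    case (27) then show ?case by (simp add: transformation_groupoid_fibres[OF G M(1) act])
  qed (use M fib fib' in \<open>auto simp: act_inv act_mult act_one m_assoc\<close>)
qed

end

theory Submission
  imports Defs
begin

text \<open>Write \<open>\<G> = \<Gamma> \<ltimes> X\<close>. States are transported between \<open>\<S>(\<Gamma>)\<close> and \<open>\<S>(\<G>)\<close> in both directions, along two
  maps that intertwine the translations.

  From the groupoid to the group, a function \<open>f\<close> on \<open>\<Gamma>\<close> is lifted to \<open>(g, x) \<mapsto> f g\<close>. A local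
  bisection \<open>\<theta>\<close> is a countable disjoint union of pieces \<open>{t} \<times> A t\<close> whose ranges \<open>t A t\<close> are also disjoint,
  so all but finitely many of the pieces have ranges of small total measure. Outside those ranges the
  lift changes under \<open>\<theta>\<close> by one of finitely many functions \<open>f - R\<^sub>t f\<close>, each small off a
  finite subset of \<open>\<Gamma>\<close>, and a finite subset times \<open>X\<close> has finite measure in \<open>\<G>\<close>. Hence the lift lies
  in \<open>\<S>(\<G>)\<close> (\<open>lift_in_groupoid_S\<close>). Composing an invariant state with the lift gives a state on
  \<open>\<S>(\<Gamma>)\<close>, whose invariance under \<open>t\<close> is the invariance under the bisection \<open>{t} \<times> X\<close>.

  From the group to the groupoid, a function \<open>f\<close> on \<open>\<G>\<close> is averaged over the fibres,
  \<open>g \<mapsto> \<integral> f(g, x) d\<mu>(x)\<close>. A set of finite measure in \<open>\<G>\<close> has only finitely many fibres of measure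
  \<open>\<ge> \<delta>\<close>, so averaging takes \<open>c\<^sub>0(\<G>)\<close> to \<open>c\<^sub>0(\<Gamma>)\<close> (\<open>fibre_mean_in_group_c0\<close>), and invariance of \<open>\<mu>\<close> makes it
  commute with right translations, so it takes \<open>\<S>(\<G>)\<close> to \<open>\<S>(\<Gamma>)\<close> (\<open>fibre_mean_in_group_S\<close>). The average of
  \<open>f \<circ> r\<close> is the constant \<open>\<integral> f d\<mu>\<close>, so the state obtained by averaging restricts on the unit space to
  integration, which is normal (\<open>fibre_mean_normal\<close>). For its invariance under \<open>\<theta>\<close>, each piece
  \<open>{t} \<times> A t\<close> contributes a difference \<open>m - L\<^sub>t m\<close> with \<open>m \<in> \<S>(\<Gamma>)\<close>, which the state on \<open>\<S>(\<Gamma>)\<close> annihilates; the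
  pieces outside a large finite set contribute a uniformly small function, and states are norm
  continuous (\<open>fibre_mean_left_invariant\<close>).\<close>

section \<open>Integration on finite measure spaces\<close>

lemma measurable_countable_pieces:
  fixes u :: "'a \<Rightarrow> 'b::topological_space"
  assumes I: "countable I" and A: "\<And>i. i \<in> I \<Longrightarrow> A i \<in> sets M"
    and F: "\<And>i. i \<in> I \<Longrightarrow> F i \<in> borel_measurable M"
    and on: "\<And>i x. i \<in> I \<Longrightarrow> x \<in> A i \<Longrightarrow> u x = F i x"
    and off: "\<And>x. x \<in> space M \<Longrightarrow> x \<notin> (\<Union>i\<in>I. A i) \<Longrightarrow> u x = c"
  shows "u \<in> borel_measurable M"
proof (rule measurable_piecewise_restrict)
  let ?C = "insert (space M - (\<Union>i\<in>I. A i)) (A ` I)"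
  show "countable ?C" using I by simp
  show "\<Omega> \<inter> space M \<in> sets M" if "\<Omega> \<in> ?C" for \<Omega>
    using that A I by (auto intro!: sets.countable_UN')
  show "space M \<subseteq> \<Union>?C" by auto
  fix \<Omega> assume "\<Omega> \<in> ?C"
  then consider i where "i \<in> I" "\<Omega> = A i" | "\<Omega> = space M - (\<Union>i\<in>I. A i)" by blast
  then show "u \<in> borel_measurable (restrict_space M \<Omega>)"
  proof cases
    case 1
    then show ?thesis
      using measurable_restrict_space1[OF F[OF 1(1)], of \<Omega>] on
      by (subst measurable_cong[of _ _ "F i"]) (auto simp: space_restrict_space)
  next
    case 2
    then show ?thesis
      using off by (subst measurable_cong[of _ _ "\<lambda>_. c"]) (auto simp: space_restrict_space)
  qed
qed

text \<open>Along an enumeration of the index set the tails decrease to the empty set, because a point lies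
  in at most one member of the family and is lost once that member has been passed.\<close>

lemma (in finite_measure) disjoint_family_small_tail:
  assumes I: "countable I" and A: "\<And>i. i \<in> I \<Longrightarrow> A i \<in> sets M"
    and disj: "disjoint_family_on A I" and \<epsilon>: "\<epsilon> > 0"
  obtains T where "finite T" "T \<subseteq> I" "measure M (\<Union>i\<in>I - T. A i) < \<epsilon>"
proof (cases "I = {}")
  case True
  then show ?thesis using that[of "{}"] \<epsilon> by simp
next
  case False
  let ?T = "\<lambda>n. from_nat_into I ` {..<n}"
  let ?D = "\<lambda>n. \<Union>i\<in>I - ?T n. A i"
  have "(\<Inter>n. ?D n) = {}"
  proof (rule ccontr)
    assume "(\<Inter>n. ?D n) \<noteq> {}"
    then obtain x where x: "\<And>n. x \<in> ?D n" by blast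
    obtain i where i: "i \<in> I" "x \<in> A i" using x[of 0] by blast
    define n where "n = Suc (to_nat_on I i)"
    have "i \<in> ?T n"
      using I i(1) by (auto simp: n_def image_iff intro!: bexI[of _ "to_nat_on I i"])
    then obtain j where "j \<in> I" "j \<noteq> i" "x \<in> A j"
      using x[of n] by blast
    then show False using disj i unfolding disjoint_family_on_def by blast
  qed
  moreover have "(\<lambda>n. measure M (?D n)) \<longlonglongrightarrow> measure M (\<Inter>n. ?D n)"
  proof (rule finite_Lim_measure_decseq)
    show "range ?D \<subseteq> sets M"
      using I A by (auto intro!: sets.countable_UN')
    show "decseq ?D" by (intro decseq_SucI) auto
  qed
  ultimately have "(\<lambda>n. measure M (?D n)) \<longlonglongrightarrow> 0" by simp
  then obtain n where "measure M (?D n) < \<epsilon>"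
    using order_tendstoD(2)[OF _ \<epsilon>] eventually_sequentially by (metis (no_types, lifting) order_refl)
  moreover have "?T n \<subseteq> I" using from_nat_into[OF False] by blast
  ultimately show ?thesis using that[of "?T n"] by blast
qed

lemma (in finite_measure) Linfty_integrable:
  fixes f :: "'a \<Rightarrow> 'b::{banach, second_countable_topology}"
  assumes "f \<in> Linfty M"
  shows "integrable M f"
proof -
  obtain C where "f \<in> borel_measurable M" "AE x in M. norm (f x) \<le> C"
    using assms unfolding Linfty_def by blast
  then show ?thesis by (rule integrable_const_bound[rotated])
qed

text \<open>Normality of the integral on \<open>L\<^sup>\<infinity>\<close>. Choose a sequence in \<open>D\<close> whose integrals approach their
  supremum \<open>c\<close>, and let \<open>H\<close> be its pointwise supremum. Directedness keeps the integral of a finite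
  maximum of members of \<open>D\<close> below \<open>c\<close>. Hence no member of \<open>D\<close> can exceed \<open>H\<close> on a set of positive
  measure, so \<open>H\<close> bounds \<open>D\<close> and \<open>F \<le> H\<close>; and \<open>H\<close>, the limit of the maxima \<open>m n\<close>, has integral at
  most \<open>c\<close>.\<close>

lemma (in finite_measure) integral_Linfty_lub_approx:
  assumes D: "D \<noteq> {}" "D \<subseteq> Linfty M"
    and dir: "\<forall>f\<in>D. \<forall>g\<in>D. \<exists>h\<in>D. (AE x in M. f x \<le> h x) \<and> (AE x in M. g x \<le> h x)"
    and lub: "Linfty_lub M D F" and \<epsilon>: "\<epsilon> > 0"
  shows "\<exists>f\<in>D. integral\<^sup>L M F - integral\<^sup>L M f < \<epsilon>"
proof -
  have F: "F \<in> Linfty M" "\<And>f. f \<in> D \<Longrightarrow> AE x in M. f x \<le> F x"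
      "\<And>H. H \<in> Linfty M \<Longrightarrow> (\<And>f. f \<in> D \<Longrightarrow> AE x in M. f x \<le> H x) \<Longrightarrow> AE x in M. F x \<le> H x"
    using lub unfolding Linfty_lub_def by blast+
  have int: "integrable M f" if "f \<in> D" for f
    using D that Linfty_integrable by blast
  have int_F: "integrable M F" using F(1) by (rule Linfty_integrable)
  define c where "c = (SUP f\<in>D. integral\<^sup>L M f)"
  have bdd: "bdd_above (integral\<^sup>L M ` D)"
    using F(2) int int_F by (intro bdd_aboveI2[of _ _ "integral\<^sup>L M F"] integral_mono_AE)
  have le_c: "integral\<^sup>L M f \<le> c" if "f \<in> D" for f
    unfolding c_def using cSUP_upper[OF that bdd] .
  have "\<exists>f\<in>D. c - 1 / Suc n < integral\<^sup>L M f" for n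
    unfolding less_cSUP_iff[OF D(1) bdd, symmetric] c_def[symmetric] by simp
  then obtain f where f: "\<And>n. f n \<in> D" "\<And>n. c - 1 / Suc n < integral\<^sup>L M (f n)"
    by metis
  define m where "m n x = Max ((\<lambda>i. f i x) ` {..n})" for n x
  have m_Suc: "m (Suc n) x = max (f (Suc n) x) (m n x)" for n x
    by (simp add: m_def atMost_Suc)
  have f_le_m: "f i x \<le> m n x" if "i \<le> n" for i n x
    using that by (auto simp: m_def)
  have f_meas: "f n \<in> borel_measurable M" for n
    using f(1) D unfolding Linfty_def by blast
  have m_meas: "m n \<in> borel_measurable M" for n
  proof (induction n)
    case 0
    have "m 0 = f 0" by (simp add: m_def fun_eq_iff)
    then show ?case using f_meas by simp
  next
    case (Suc n)
    have "m (Suc n) = (\<lambda>x. max (f (Suc n) x) (m n x))" by (simp add: m_Suc fun_eq_iff)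
    then show ?case using Suc f_meas[of "Suc n"] by simp
  qed
  have m_le: "\<exists>h\<in>D. AE x in M. m n x \<le> h x" for n
  proof (induction n)
    case 0
    have "m 0 = f 0" by (simp add: m_def fun_eq_iff)
    then show ?case using f(1)[of 0] by (intro bexI[of _ "f 0"]) auto
  next
    case (Suc n)
    then obtain h where h: "h \<in> D" "AE x in M. m n x \<le> h x" by blast
    obtain k where k: "k \<in> D" "AE x in M. h x \<le> k x" "AE x in M. f (Suc n) x \<le> k x"
      using dir h(1) f(1)[of "Suc n"] by blast
    have "AE x in M. m (Suc n) x \<le> k x"
      using h(2) k(2,3) by eventually_elim (simp add: m_Suc)
    then show ?case using k(1) by blast
  qed
  \<comment> \<open>A limit instead of a supremum keeps \<open>H\<close> measurable also on the null set where the maxima are unbounded.\<close>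
  define H where "H x = lim (\<lambda>n. m n x)" for x
  have H_meas: "H \<in> borel_measurable M"
    unfolding H_def using m_meas by (rule borel_measurable_lim_metric)
  have "AE x in M. \<forall>n. f n x \<le> F x"
    unfolding AE_all_countable using F(2) f(1) by blast
  then have conv: "AE x in M. (\<lambda>n. m n x) \<longlonglongrightarrow> H x \<and> (\<forall>n. f n x \<le> H x) \<and> (\<forall>n. m n x \<le> F x) \<and> H x \<le> F x"
  proof eventually_elim
    case (elim x)
    have inc: "incseq (\<lambda>n. m n x)" by (rule incseq_SucI) (simp add: m_Suc)
    have bound: "m n x \<le> F x" for n using elim by (auto simp: m_def)
    obtain L where L: "(\<lambda>n. m n x) \<longlonglongrightarrow> L" "\<And>n. m n x \<le> L"
      using incseq_convergent[OF inc, of "F x"] bound by blast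
    have "H x = L" unfolding H_def using L(1) by (rule limI)
    moreover have "L \<le> F x" using L(1) bound by (intro LIMSEQ_le_const2) auto
    ultimately show ?case using L bound f_le_m by (metis order_refl order_trans)
  qed
  have "H \<in> Linfty M"
  proof -
    obtain A B where A: "AE x in M. norm (f 0 x) \<le> A" and B: "AE x in M. norm (F x) \<le> B"
      using F(1) f(1)[of 0] D unfolding Linfty_def by blast
    have "AE x in M. norm (H x) \<le> A + B"
      using A B conv
    proof eventually_elim
      case (elim x)
      then have "f 0 x \<le> H x" "H x \<le> F x" by auto
      then show ?case using elim(1,2) by (auto simp: abs_le_iff)
    qed
    then show ?thesis unfolding Linfty_def using H_meas by blast
  qed
  moreover have "AE x in M. g x \<le> H x" if g: "g \<in> D" for g
  proof -
    \<comment> \<open>Some \<open>h\<close> in \<open>D\<close> dominates both \<open>g\<close> and \<open>f n\<close>, so the excess of \<open>g\<close> over \<open>H\<close> is at most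
      \<open>h - f n\<close>, whose integral is at most \<open>1 / Suc n\<close>.\<close>
    let ?e = "\<lambda>x. max 0 (g x - H x)"
    have int_e: "integrable M ?e"
      using int[OF g] Linfty_integrable[OF \<open>H \<in> Linfty M\<close>] by auto
    have "integral\<^sup>L M ?e \<le> 1 / Suc n" for n
    proof -
      obtain h where h: "h \<in> D" "AE x in M. g x \<le> h x" "AE x in M. f n x \<le> h x"
        using dir g f(1) by blast
      have "integral\<^sup>L M ?e \<le> (\<integral>x. h x - f n x \<partial>M)"
      proof (rule integral_mono_AE[OF int_e])
        show "integrable M (\<lambda>x. h x - f n x)" using int h(1) f(1) by auto
        show "AE x in M. ?e x \<le> h x - f n x"
          using h(2,3) conv
        proof eventually_elim
          case (elim x)
          then have "f n x \<le> H x" by blast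
          then show ?case using elim(1,2) by auto
        qed
      qed
      also have "\<dots> = integral\<^sup>L M h - integral\<^sup>L M (f n)"
        using int h(1) f(1) by simp
      also have "\<dots> \<le> 1 / Suc n"
        using le_c[OF h(1)] f(2)[of n] by simp
      finally show ?thesis .
    qed
    then have "integral\<^sup>L M ?e \<le> 0"
      by (intro LIMSEQ_le_const[OF LIMSEQ_Suc[OF lim_1_over_n]]) auto
    then have "integral\<^sup>L M ?e = 0"
      by (intro antisym integral_nonneg_AE) auto
    then have "AE x in M. ?e x = 0"
      by (subst (asm) integral_nonneg_eq_0_iff_AE[OF int_e]) auto
    then show ?thesis by eventually_elim auto
  qed
  ultimately have F_le: "AE x in M. F x \<le> H x" by (rule F(3))
  have "(\<lambda>n. integral\<^sup>L M (m n)) \<longlonglongrightarrow> integral\<^sup>L M H"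
  proof (rule integral_dominated_convergence)
    show "integrable M (\<lambda>x. \<bar>f 0 x\<bar> + \<bar>F x\<bar>)" using int f(1) int_F by auto
    show "AE x in M. (\<lambda>n. m n x) \<longlonglongrightarrow> H x" using conv by eventually_elim blast
    show "AE x in M. norm (m n x) \<le> \<bar>f 0 x\<bar> + \<bar>F x\<bar>" for n
      using conv
    proof eventually_elim
      case (elim x)
      then have "m n x \<le> F x" "f 0 x \<le> m n x" using f_le_m by auto
      then show ?case by auto
    qed
  qed (use H_meas m_meas in auto)
  moreover have "integral\<^sup>L M (m n) \<le> c" for n
  proof -
    obtain h where h: "h \<in> D" "AE x in M. m n x \<le> h x" using m_le by blast
    have "integral\<^sup>L M (m n) \<le> integral\<^sup>L M h"
    proof (rule integral_mono_AE)
      show "integrable M (m n)"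
      proof (rule Bochner_Integration.integrable_bound)
        show "integrable M (\<lambda>x. \<bar>f 0 x\<bar> + \<bar>h x\<bar>)" using int f(1) h(1) by auto
        show "AE x in M. norm (m n x) \<le> norm (\<bar>f 0 x\<bar> + \<bar>h x\<bar>)"
          using h(2)
        proof eventually_elim
          case (elim x)
          have "f 0 x \<le> m n x" by (simp add: f_le_m)
          then show ?case using elim by auto
        qed
      qed (rule m_meas)
    qed (use h int in auto)
    then show ?thesis using le_c[OF h(1)] by simp
  qed
  ultimately have "integral\<^sup>L M H \<le> c" by (intro LIMSEQ_le_const2) auto
  moreover have "integral\<^sup>L M F \<le> integral\<^sup>L M H"
    by (rule integral_mono_AE[OF int_F Linfty_integrable[OF \<open>H \<in> Linfty M\<close>] F_le])
  moreover obtain g where "g \<in> D" "c - \<epsilon> < integral\<^sup>L M g"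
    using less_cSUP_iff[OF D(1) bdd, of "c - \<epsilon>"] \<epsilon> by (auto simp: c_def)
  ultimately show ?thesis by (intro bexI[of _ g]) auto
qed

text \<open>Applied to the slices of a bisection, this splits a translate into its finitely many main parts and a
  remainder supported over a tail of slices.\<close>

lemma disjoint_family_partial_sum:
  fixes b :: complex
  assumes disj: "disjoint_family_on A I" and T: "finite T" "T \<subseteq> I"
    and on: "\<And>i. i \<in> I \<Longrightarrow> y \<in> A i \<Longrightarrow> b = c i" and off: "y \<notin> (\<Union>i\<in>I. A i) \<Longrightarrow> b = 0"
  shows "b - (\<Sum>i\<in>T. c i * indicator (A i) y) = b * indicator (\<Union>i\<in>I - T. A i) y"
proof (cases "\<exists>j\<in>T. y \<in> A j")
  case True
  then obtain j where j: "j \<in> T" "y \<in> A j" by blast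
  have other: "y \<notin> A i" if "i \<in> I" "i \<noteq> j" for i
    using disj that j T(2) unfolding disjoint_family_on_def by blast
  have "(\<Sum>i\<in>T. c i * indicator (A i) y) = (\<Sum>i\<in>{j}. c i * indicator (A i) y)"
    using T j other by (intro sum.mono_neutral_right) (auto simp: indicator_def)
  moreover have "y \<notin> (\<Union>i\<in>I - T. A i)" using other j(1) by blast
  ultimately show ?thesis using on[of j] j T(2) by auto
next
  case False
  then have "(\<Sum>i\<in>T. c i * indicator (A i) y) = 0"
    by (intro sum.neutral) (auto simp: indicator_def)
  then show ?thesis using False off by (auto simp: indicator_def)
qed

lemma (in finite_measure) integrable_indicator_real:
  "A \<in> sets M \<Longrightarrow> integrable M (indicator A :: 'a \<Rightarrow> real)"
  by (rule integrable_real_indicator) (auto simp: emeasure_eq_measure)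

section \<open>Slowly varying functions and states on a group\<close>

text \<open>Positivity alone makes a state blind to null sets: both \<open>u - v\<close> and \<open>v - u\<close> are nonnegative almost
  everywhere, so their values are nonnegative, and these values are opposite.\<close>

lemma state_on_cong:
  assumes \<phi>: "state_on N A \<phi>" and u: "u \<in> A" and v: "v \<in> A"
    and diff: "(\<lambda>x. u x - v x) \<in> A" "(\<lambda>x. v x - u x) \<in> A"
    and eq: "AE x in N. u x = v x"
  shows "\<phi> u = \<phi> v"
proof -
  have scale: "\<phi> (\<lambda>x. c * f x) = c * \<phi> f" if "f \<in> A" for c f
    using \<phi> that unfolding state_on_def by blast
  have add: "\<phi> (\<lambda>x. f x + g x) = \<phi> f + \<phi> g" if "f \<in> A" "g \<in> A" for f g
    using \<phi> that unfolding state_on_def by blast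
  have pos: "\<phi> f \<in> \<real>\<^sub>\<ge>\<^sub>0" if "f \<in> A" "AE x in N. f x \<in> \<real>\<^sub>\<ge>\<^sub>0" for f
    using \<phi> that unfolding state_on_def by blast
  have "\<phi> (\<lambda>x. u x - v x) \<in> \<real>\<^sub>\<ge>\<^sub>0"
    using diff(1) by (rule pos) (use eq in eventually_elim, simp)
  moreover have "\<phi> (\<lambda>x. v x - u x) \<in> \<real>\<^sub>\<ge>\<^sub>0"
    using diff(2) by (rule pos) (use eq in eventually_elim, simp)
  moreover have "\<phi> (\<lambda>x. v x - u x) = - \<phi> (\<lambda>x. u x - v x)"
    using scale[OF diff(1), of "-1"] by simp
  ultimately have "\<phi> (\<lambda>x. u x - v x) = 0"
    by (auto simp: complex_nonneg_Reals_iff complex_eq_iff)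
  then show ?thesis
    using add[OF diff(1) v] by simp
qed

context group
begin

lemma group_c0_dominated:
  assumes f: "f \<in> group_c0 G" and g: "g \<in> group_c0 G"
    and h: "\<And>s. s \<in> carrier G \<Longrightarrow> norm (h s) \<le> C * (norm (f s) + norm (g s))"
  shows "h \<in> group_c0 G"
  unfolding group_c0_def
proof (intro CollectI allI impI)
  fix \<epsilon> :: real assume \<epsilon>: "\<epsilon> > 0"
  define \<delta> where "\<delta> = \<epsilon> / (2 * (\<bar>C\<bar> + 1))"
  have \<delta>: "\<delta> > 0" "\<delta> * (2 * (\<bar>C\<bar> + 1)) = \<epsilon>"
    using \<epsilon> by (auto simp: \<delta>_def add_nonneg_pos)
  have fin: "finite ({s \<in> carrier G. norm (f s) \<ge> \<delta>} \<union> {s \<in> carrier G. norm (g s) \<ge> \<delta>})"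
    using f g \<delta>(1) unfolding group_c0_def by auto
  show "finite {s \<in> carrier G. \<epsilon> \<le> norm (h s)}"
  proof (rule finite_subset[OF _ fin], rule subsetI, rule ccontr)
    fix s assume s: "s \<in> {s \<in> carrier G. \<epsilon> \<le> norm (h s)}"
      and small: "s \<notin> {s \<in> carrier G. norm (f s) \<ge> \<delta>} \<union> {s \<in> carrier G. norm (g s) \<ge> \<delta>}"
    have "norm (h s) \<le> C * (norm (f s) + norm (g s))"
      using s h by simp
    also have "\<dots> \<le> \<bar>C\<bar> * (norm (f s) + norm (g s))"
      by (intro mult_right_mono) auto
    also have "\<dots> \<le> (\<bar>C\<bar> + 1) * (norm (f s) + norm (g s))"
      by (intro mult_right_mono) auto
    also have "\<dots> < (\<bar>C\<bar> + 1) * (\<delta> + \<delta>)"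
      using s small by (intro mult_strict_left_mono) auto
    also have "\<dots> = \<epsilon>" using \<delta>(2) by (simp add: algebra_simps)
    finally show False using s by simp
  qed
qed

lemma group_S_iff:
  "f \<in> group_S G \<longleftrightarrow> (\<exists>C. \<forall>s\<in>carrier G. norm (f s) \<le> C) \<and>
     (\<forall>t\<in>carrier G. (\<lambda>s. f s - f (s \<otimes> t)) \<in> group_c0 G)"
  unfolding group_S_def Linfty_def by (simp add: AE_count_space)

lemma const_in_group_S: "(\<lambda>s. c) \<in> group_S G"
  unfolding group_S_iff group_c0_def by auto

text \<open>Membership in \<open>\<S>(\<Gamma>)\<close> concerns only the increments of a function, so it passes to every function
  whose increments are controlled by those of members. Sums, differences, real and imaginary parts
  and modification off the carrier are all instances.\<close>

lemma group_S_lipschitz: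
  assumes f: "f \<in> group_S G" and g: "g \<in> group_S G"
    and h: "\<And>s s'. s \<in> carrier G \<Longrightarrow> s' \<in> carrier G \<Longrightarrow>
        norm (h s - h s') \<le> L * (norm (f s - f s') + norm (g s - g s'))"
  shows "h \<in> group_S G"
proof -
  obtain A B where A: "\<And>s. s \<in> carrier G \<Longrightarrow> norm (f s) \<le> A"
      and B: "\<And>s. s \<in> carrier G \<Longrightarrow> norm (g s) \<le> B"
    using f g unfolding group_S_iff by blast
  have "norm (h s) \<le> norm (h \<one>) + \<bar>L\<bar> * (2 * A + 2 * B)" if s: "s \<in> carrier G" for s
  proof -
    have "norm (h s) \<le> norm (h \<one>) + norm (h s - h \<one>)"
      by (metis norm_triangle_sub)
    also have "norm (h s - h \<one>) \<le> \<bar>L\<bar> * (norm (f s - f \<one>) + norm (g s - g \<one>))"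
      using h[OF s one_closed] by (rule order_trans) (intro mult_right_mono, auto)
    also have "norm (f s - f \<one>) \<le> 2 * A"
      using A[OF s] A[OF one_closed] norm_triangle_ineq4[of "f s" "f \<one>"] by linarith
    also have "norm (g s - g \<one>) \<le> 2 * B"
      using B[OF s] B[OF one_closed] norm_triangle_ineq4[of "g s" "g \<one>"] by linarith
    finally show ?thesis by (simp add: mult_left_mono)
  qed
  moreover have "(\<lambda>s. h s - h (s \<otimes> t)) \<in> group_c0 G" if t: "t \<in> carrier G" for t
  proof (rule group_c0_dominated)
    show "(\<lambda>s. f s - f (s \<otimes> t)) \<in> group_c0 G" "(\<lambda>s. g s - g (s \<otimes> t)) \<in> group_c0 G"
      using f g t unfolding group_S_iff by blast+
  qed (use h t in blast)
  ultimately show ?thesis unfolding group_S_iff by blast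
qed

lemma group_S_add:
  assumes "f \<in> group_S G" "g \<in> group_S G"
  shows "(\<lambda>s. f s + g s) \<in> group_S G"
proof (rule group_S_lipschitz[OF assms, where L = 1])
  fix s s'
  show "norm (f s + g s - (f s' + g s')) \<le> 1 * (norm (f s - f s') + norm (g s - g s'))"
    using norm_triangle_ineq[of "f s - f s'" "g s - g s'"] by (simp add: algebra_simps)
qed

lemma group_S_diff:
  assumes "f \<in> group_S G" "g \<in> group_S G"
  shows "(\<lambda>s. f s - g s) \<in> group_S G"
proof (rule group_S_lipschitz[OF assms, where L = 1])
  fix s s'
  show "norm (f s - g s - (f s' - g s')) \<le> 1 * (norm (f s - f s') + norm (g s - g s'))"
    using norm_triangle_ineq4[of "f s - f s'" "g s - g s'"] by (simp add: algebra_simps)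
qed

lemma group_S_cong:
  assumes "f \<in> group_S G" "\<And>s. s \<in> carrier G \<Longrightarrow> h s = f s"
  shows "h \<in> group_S G"
  using assms by (intro group_S_lipschitz[OF assms(1) assms(1), where L = 1]) auto

lemma group_S_sum:
  assumes "finite T" "\<And>t. t \<in> T \<Longrightarrow> f t \<in> group_S G"
  shows "(\<lambda>s. \<Sum>t\<in>T. f t s) \<in> group_S G"
  using assms by (induction T) (auto intro: const_in_group_S group_S_add)

lemma group_S_translate:
  assumes f: "f \<in> group_S G" and t: "t \<in> carrier G"
  shows "(\<lambda>s. f (inv t \<otimes> s)) \<in> group_S G"
proof -
  obtain C where C: "\<And>s. s \<in> carrier G \<Longrightarrow> norm (f s) \<le> C"
    using f unfolding group_S_iff by blast
  have "(\<lambda>s. f (inv t \<otimes> s) - f (inv t \<otimes> (s \<otimes> r))) \<in> group_c0 G" if r: "r \<in> carrier G" for r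
    unfolding group_c0_def
  proof (intro CollectI allI impI)
    fix \<epsilon> :: real assume "\<epsilon> > 0"
    then have fin: "finite {s \<in> carrier G. \<epsilon> \<le> norm (f s - f (s \<otimes> r))}" (is "finite ?E")
      using f r unfolding group_S_iff group_c0_def by auto
    have "{s \<in> carrier G. \<epsilon> \<le> norm (f (inv t \<otimes> s) - f (inv t \<otimes> (s \<otimes> r)))} \<subseteq> (\<otimes>) t ` ?E"
    proof
      fix s assume s: "s \<in> {s \<in> carrier G. \<epsilon> \<le> norm (f (inv t \<otimes> s) - f (inv t \<otimes> (s \<otimes> r)))}"
      then have "inv t \<otimes> s \<in> ?E" using t r by (simp add: m_assoc)
      moreover have "s = t \<otimes> (inv t \<otimes> s)"
        using s t by (simp add: m_assoc[symmetric])
      ultimately show "s \<in> (\<otimes>) t ` ?E" by blast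
    qed
    then show "finite {s \<in> carrier G. \<epsilon> \<le> norm (f (inv t \<otimes> s) - f (inv t \<otimes> (s \<otimes> r)))}"
      using fin finite_surj by blast
  qed
  then show ?thesis
    using C t unfolding group_S_iff by (meson inv_closed m_closed)
qed

lemma group_S_uniform_limit:
  assumes u: "\<And>\<epsilon>. \<epsilon> > 0 \<Longrightarrow> \<exists>w\<in>group_S G. \<forall>s\<in>carrier G. norm (u s - w s) \<le> \<epsilon>"
  shows "u \<in> group_S G"
proof -
  obtain w where w: "w \<in> group_S G" "\<And>s. s \<in> carrier G \<Longrightarrow> norm (u s - w s) \<le> 1"
    using u[of 1] by auto
  obtain C where C: "\<And>s. s \<in> carrier G \<Longrightarrow> norm (w s) \<le> C"
    using w(1) unfolding group_S_iff by blast
  have "norm (u s) \<le> C + 1" if "s \<in> carrier G" for s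
    using C[OF that] w(2)[OF that] norm_triangle_sub[of "u s" "w s"] by linarith
  moreover have "(\<lambda>s. u s - u (s \<otimes> t)) \<in> group_c0 G" if t: "t \<in> carrier G" for t
    unfolding group_c0_def
  proof (intro CollectI allI impI)
    fix \<epsilon> :: real assume \<epsilon>: "\<epsilon> > 0"
    obtain w where w: "w \<in> group_S G" "\<And>s. s \<in> carrier G \<Longrightarrow> norm (u s - w s) \<le> \<epsilon> / 4"
      using u[of "\<epsilon> / 4"] \<epsilon> by auto
    have fin: "finite {s \<in> carrier G. \<epsilon> / 2 \<le> norm (w s - w (s \<otimes> t))}"
      using w(1) t half_gt_zero[OF \<epsilon>] unfolding group_S_iff group_c0_def by blast
    show "finite {s \<in> carrier G. \<epsilon> \<le> norm (u s - u (s \<otimes> t))}"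
    proof (rule finite_subset[OF _ fin], safe)
      fix s assume s: "s \<in> carrier G" and large: "\<epsilon> \<le> norm (u s - u (s \<otimes> t))"
      have "norm (u s - u (s \<otimes> t)) =
          norm ((u s - w s) + (w s - w (s \<otimes> t)) - (u (s \<otimes> t) - w (s \<otimes> t)))"
        by simp
      also have "\<dots> \<le> norm (u s - w s) + norm (w s - w (s \<otimes> t)) + norm (u (s \<otimes> t) - w (s \<otimes> t))"
        by (meson add_mono norm_triangle_ineq norm_triangle_ineq4 order_refl order_trans)
      finally show "\<epsilon> / 2 \<le> norm (w s - w (s \<otimes> t))"
        using large w(2)[OF s] w(2)[OF m_closed[OF s t]] by linarith
    qed
  qed
  ultimately show ?thesis unfolding group_S_iff by blast
qed

lemma group_state_cong:
  assumes \<phi>: "state_on (count_space (carrier G)) (group_S G) \<phi>"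
    and f: "f \<in> group_S G" and eq: "\<And>s. s \<in> carrier G \<Longrightarrow> h s = f s"
  shows "\<phi> h = \<phi> f"
  using \<phi> by (rule state_on_cong)
    (use group_S_cong[OF f eq] f eq in \<open>auto intro: group_S_diff simp: AE_count_space\<close>)

lemma group_state_linear:
  assumes \<phi>: "state_on (count_space (carrier G)) (group_S G) \<phi>"
    and f: "f \<in> group_S G" and g: "g \<in> group_S G"
  shows "\<phi> (\<lambda>s. f s + g s) = \<phi> f + \<phi> g" "\<phi> (\<lambda>s. c * f s) = c * \<phi> f"
    "\<phi> (\<lambda>s. f s - g s) = \<phi> f - \<phi> g" "\<phi> (\<lambda>s. c) = c"
proof -
  have scale: "\<phi> (\<lambda>s. c * f s) = c * \<phi> f" if "f \<in> group_S G" for c f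
    using \<phi> that unfolding state_on_def by blast
  have add: "\<phi> (\<lambda>s. f s + g s) = \<phi> f + \<phi> g" if "f \<in> group_S G" "g \<in> group_S G" for f g
    using \<phi> that unfolding state_on_def by blast
  have "\<phi> (\<lambda>s. 1) = 1" using \<phi> unfolding state_on_def by blast
  then show "\<phi> (\<lambda>s. c) = c" using scale[OF const_in_group_S[of 1], of c] by simp
  show "\<phi> (\<lambda>s. f s - g s) = \<phi> f - \<phi> g"
    using add[OF group_S_diff[OF f g] g] by simp
  show "\<phi> (\<lambda>s. f s + g s) = \<phi> f + \<phi> g" "\<phi> (\<lambda>s. c * f s) = c * \<phi> f"
    using add[OF f g] scale[OF f] by blast+
qed

text \<open>Real functions bounded by \<open>\<epsilon>\<close> have values in \<open>[-\<epsilon>, \<epsilon>]\<close> by positivity; the factor \<open>2\<close> is the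
  price of treating real and imaginary parts separately, and any constant suffices for continuity.\<close>

lemma group_state_bound:
  assumes \<phi>: "state_on (count_space (carrier G)) (group_S G) \<phi>"
    and f: "f \<in> group_S G" and bound: "\<And>s. s \<in> carrier G \<Longrightarrow> norm (f s) \<le> \<epsilon>"
  shows "norm (\<phi> f) \<le> 2 * \<epsilon>"
proof -
  note linear = group_state_linear[OF \<phi>]
  have pos: "\<phi> v \<in> \<real>\<^sub>\<ge>\<^sub>0" if "v \<in> group_S G" "\<And>s. s \<in> carrier G \<Longrightarrow> v s \<in> \<real>\<^sub>\<ge>\<^sub>0" for v
    using \<phi> that unfolding state_on_def by (auto simp: AE_count_space)
  have real: "norm (\<phi> (\<lambda>s. of_real (v s))) \<le> \<epsilon>"
    if v: "(\<lambda>s. of_real (v s)) \<in> group_S G" and le: "\<And>s. s \<in> carrier G \<Longrightarrow> \<bar>v s\<bar> \<le> \<epsilon>"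
    for v :: "'a \<Rightarrow> real"
  proof -
    let ?v = "\<lambda>s. complex_of_real (v s)" and ?e = "\<lambda>s. complex_of_real \<epsilon>"
    have e: "?e \<in> group_S G" by (rule const_in_group_S)
    have "\<phi> (\<lambda>s. ?e s - ?v s) \<in> \<real>\<^sub>\<ge>\<^sub>0"
      by (intro pos group_S_diff e v) (use le in \<open>force simp: complex_nonneg_Reals_iff\<close>)
    moreover have "\<phi> (\<lambda>s. ?e s + ?v s) \<in> \<real>\<^sub>\<ge>\<^sub>0"
      by (intro pos group_S_add e v) (use le in \<open>force simp: complex_nonneg_Reals_iff\<close>)
    ultimately have "of_real \<epsilon> - \<phi> ?v \<in> \<real>\<^sub>\<ge>\<^sub>0" "of_real \<epsilon> + \<phi> ?v \<in> \<real>\<^sub>\<ge>\<^sub>0"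
      using linear(1)[OF e v] linear(3)[OF e v] linear(4)[OF e v, of "of_real \<epsilon>"] by simp_all
    then have "Im (\<phi> ?v) = 0" "\<bar>Re (\<phi> ?v)\<bar> \<le> \<epsilon>"
      by (auto simp: complex_nonneg_Reals_iff)
    then show ?thesis by (simp add: cmod_def)
  qed
  have parts: "\<bar>Re z\<bar> \<le> cmod z" "\<bar>Im z\<bar> \<le> cmod z" for z
    by (simp_all add: abs_Re_le_cmod abs_Im_le_cmod)
  have Re: "(\<lambda>s. of_real (Re (f s))) \<in> group_S G"
    by (rule group_S_lipschitz[OF f f, where L = 1])
      (simp only: of_real_diff[symmetric] minus_complex.sel[symmetric] norm_of_real,
        use parts in \<open>smt (verit) norm_ge_zero\<close>)
  have Im: "(\<lambda>s. of_real (Im (f s))) \<in> group_S G"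
    by (rule group_S_lipschitz[OF f f, where L = 1])
      (simp only: of_real_diff[symmetric] minus_complex.sel[symmetric] norm_of_real,
        use parts in \<open>smt (verit) norm_ge_zero\<close>)
  have Im': "(\<lambda>s. \<i> * of_real (Im (f s))) \<in> group_S G"
    by (rule group_S_lipschitz[OF Im Im, where L = 1])
      (simp add: norm_mult right_diff_distrib[symmetric])
  have "f = (\<lambda>s. of_real (Re (f s)) + \<i> * of_real (Im (f s)))"
    by (simp add: complex_eq[symmetric])
  then have "\<phi> f = \<phi> (\<lambda>s. of_real (Re (f s))) + \<i> * \<phi> (\<lambda>s. of_real (Im (f s)))"
    using linear(1)[OF Re Im'] linear(2)[OF Im Im, of \<i>] by simp
  then have "norm (\<phi> f) \<le> norm (\<phi> (\<lambda>s. of_real (Re (f s)))) + norm (\<phi> (\<lambda>s. of_real (Im (f s))))"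
    using norm_triangle_ineq[of "\<phi> (\<lambda>s. of_real (Re (f s)))" "\<i> * \<phi> (\<lambda>s. of_real (Im (f s)))"]
    by (simp add: norm_mult)
  also have "\<dots> \<le> \<epsilon> + \<epsilon>"
    using bound parts by (intro add_mono real Re Im) (meson order_trans)+
  finally show ?thesis by simp
qed

text \<open>The kernel of a state is closed under uniform limits, because \<open>\<S>(\<Gamma>)\<close> is uniformly closed and the state
  is norm continuous on it.\<close>

lemma group_state_null_limit:
  assumes \<phi>: "state_on (count_space (carrier G)) (group_S G) \<phi>"
    and u: "\<And>\<epsilon>. \<epsilon> > 0 \<Longrightarrow>
        \<exists>w\<in>group_S G. \<phi> w = 0 \<and> (\<forall>s\<in>carrier G. norm (u s - w s) \<le> \<epsilon>)"
  shows "\<phi> u = 0"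
proof -
  have S: "u \<in> group_S G"
    by (rule group_S_uniform_limit) (use u in blast)
  have "norm (\<phi> u) \<le> 0 + \<epsilon>" if "\<epsilon> > 0" for \<epsilon>
  proof -
    obtain w where w: "w \<in> group_S G" "\<phi> w = 0" "\<And>s. s \<in> carrier G \<Longrightarrow> norm (u s - w s) \<le> \<epsilon> / 2"
      using u[of "\<epsilon> / 2"] \<open>\<epsilon> > 0\<close> by auto
    show ?thesis
      using group_state_bound[OF \<phi> group_S_diff[OF S w(1)] w(3)] group_state_linear(3)[OF \<phi> S w(1)] w(2)
      by simp
  qed
  then have "norm (\<phi> u) \<le> 0" by (rule field_le_epsilon)
  then show ?thesis by simp
qed

end

section \<open>Transformation groupoids and their local bisections\<close>

locale countable_pmp_action =
  fixes G :: "('g, 'm) monoid_scheme" (structure) and M :: "'x measure" and \<alpha> :: "'g \<Rightarrow> 'x \<Rightarrow> 'x"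
  assumes group_G: "group G" and countable_G: "countable (carrier G)"
    and prob_M: "prob_space M" and action: "pmp_action G M \<alpha>"
begin

sublocale group G by (rule group_G)

sublocale M: prob_space M by (rule prob_M)

abbreviation K :: "'g measure" where
  "K \<equiv> count_space (carrier G)"

abbreviation \<G> :: "('g \<times> 'x, 'x) groupoid" where
  "\<G> \<equiv> transformation_groupoid G M \<alpha>"

sublocale K: sigma_finite_measure K
  using countable_G by (rule sigma_finite_measure_count_space_countable)

sublocale KM: pair_sigma_finite K M ..

lemma act_measurable: "g \<in> carrier G \<Longrightarrow> \<alpha> g \<in> measurable M M"
  using action unfolding pmp_action_def by blast

lemma act_closed: "g \<in> carrier G \<Longrightarrow> x \<in> space M \<Longrightarrow> \<alpha> g x \<in> space M"
  using act_measurable measurable_space by metis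

lemma act_mult:
  "g \<in> carrier G \<Longrightarrow> h \<in> carrier G \<Longrightarrow> x \<in> space M \<Longrightarrow> \<alpha> (g \<otimes> h) x = \<alpha> g (\<alpha> h x)"
  using action group_action.composition_rule unfolding pmp_action_def by fast

lemma act_one: "x \<in> space M \<Longrightarrow> \<alpha> \<one> x = x"
  using action group_action.id_eq_one unfolding pmp_action_def by (metis restrict_apply')

lemma act_inv [simp]:
  "g \<in> carrier G \<Longrightarrow> x \<in> space M \<Longrightarrow> \<alpha> (inv g) (\<alpha> g x) = x"
  "g \<in> carrier G \<Longrightarrow> x \<in> space M \<Longrightarrow> \<alpha> g (\<alpha> (inv g) x) = x"
  by (simp_all add: act_mult[symmetric] act_one)

lemma act_distr: "g \<in> carrier G \<Longrightarrow> distr M M (\<alpha> g) = M"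
  using action unfolding pmp_action_def by blast

lemma act_AE:
  assumes g: "g \<in> carrier G" and P: "AE x in M. P x"
  shows "AE x in M. P (\<alpha> g x)"
proof -
  have "AE x in distr M M (\<alpha> g). P x" using P by (simp only: act_distr[OF g])
  then show ?thesis by (rule AE_distrD[OF act_measurable[OF g]])
qed

lemma act_vimage_sets:
  "g \<in> carrier G \<Longrightarrow> A \<in> sets M \<Longrightarrow> {x \<in> space M. \<alpha> g x \<in> A} \<in> sets M"
  using measurable_sets[OF act_measurable] by (simp add: vimage_def Int_def conj_commute)

lemma measure_act_vimage:
  assumes g: "g \<in> carrier G" and A: "A \<in> sets M"
  shows "measure M {x \<in> space M. \<alpha> g x \<in> A} = measure M A"
proof -
  have "measure M A = measure (distr M M (\<alpha> g)) A" by (simp add: act_distr[OF g])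
  also have "\<dots> = measure M (\<alpha> g -` A \<inter> space M)"
    by (rule measure_distr[OF act_measurable[OF g] A])
  finally show ?thesis by (simp add: vimage_def Int_def conj_commute)
qed

lemma integral_act:
  fixes f :: "'x \<Rightarrow> 'b::{banach, second_countable_topology}"
  assumes g: "g \<in> carrier G" and f: "f \<in> borel_measurable M"
  shows "(\<integral>x. f (\<alpha> g x) \<partial>M) = (\<integral>x. f x \<partial>M)"
  using integral_distr[OF act_measurable[OF g] f] by (simp add: act_distr[OF g])

lemma groupoid_simps [simp]:
  "units \<G> = M" "arrows \<G> = K \<Otimes>\<^sub>M M"
  "src \<G> (g, x) = x" "rng \<G> (g, x) = \<alpha> g x"
  "compose_arrows \<G> (g, y) (h, x) = (g \<otimes> h, x)"
  "inverse_arrow \<G> (g, x) = (inv g, \<alpha> g x)"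
  by (simp_all add: transformation_groupoid_def)

lemma arrow_measure [simp]: "arrow_measure \<G> = K \<Otimes>\<^sub>M M"
  by (rule arrow_measure_transformation_groupoid[OF countable_G prob_M action])

lemma AE_arrows:
  "(AE \<gamma> in K \<Otimes>\<^sub>M M. Q \<gamma>) \<longleftrightarrow> (\<forall>g\<in>carrier G. AE x in M. Q (g, x))"
proof
  assume "AE \<gamma> in K \<Otimes>\<^sub>M M. Q \<gamma>"
  then show "\<forall>g\<in>carrier G. AE x in M. Q (g, x)"
    using KM.AE_pair by (force simp: AE_count_space)
next
  assume "\<forall>g\<in>carrier G. AE x in M. Q (g, x)"
  then have "\<forall>g\<in>carrier G. \<exists>N. N \<in> null_sets M \<and> {x \<in> space M. \<not> Q (g, x)} \<subseteq> N"
    unfolding eventually_ae_filter by blast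
  from bchoice[OF this] obtain N where N: "\<And>g. g \<in> carrier G \<Longrightarrow> N g \<in> null_sets M"
      "\<And>g. g \<in> carrier G \<Longrightarrow> {x \<in> space M. \<not> Q (g, x)} \<subseteq> N g"
    by blast
  have "(\<Union>g\<in>carrier G. {g} \<times> N g) \<in> null_sets (K \<Otimes>\<^sub>M M)"
  proof (rule null_sets_UN'[OF countable_G])
    fix g assume g: "g \<in> carrier G"
    then show "{g} \<times> N g \<in> null_sets (K \<Otimes>\<^sub>M M)"
      using N(1)[OF g] by (auto simp: null_sets_def M.emeasure_pair_measure_Times)
  qed
  moreover have "{\<gamma> \<in> space (K \<Otimes>\<^sub>M M). \<not> Q \<gamma>} \<subseteq> (\<Union>g\<in>carrier G. {g} \<times> N g)"
    using N(2) by (auto simp: space_pair_measure)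
  ultimately show "AE \<gamma> in K \<Otimes>\<^sub>M M. Q \<gamma>"
    by (rule AE_I')
qed

lemma borel_measurable_arrows:
  "f \<in> borel_measurable (K \<Otimes>\<^sub>M M) \<longleftrightarrow> (\<forall>g\<in>carrier G. (\<lambda>x. f (g, x)) \<in> borel_measurable M)"
proof
  assume f: "f \<in> borel_measurable (K \<Otimes>\<^sub>M M)"
  show "\<forall>g\<in>carrier G. (\<lambda>x. f (g, x)) \<in> borel_measurable M"
    using measurable_compose[OF measurable_Pair1' f] by simp
qed (simp add: measurable_pair_measure_countable1[OF countable_G])

lemma Linfty_arrows:
  "f \<in> Linfty (K \<Otimes>\<^sub>M M) \<longleftrightarrow> (\<forall>g\<in>carrier G. (\<lambda>x. f (g, x)) \<in> borel_measurable M) \<and>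
     (\<exists>C. \<forall>g\<in>carrier G. AE x in M. norm (f (g, x)) \<le> C)"
  unfolding Linfty_def by (simp add: borel_measurable_arrows AE_arrows)

text \<open>The cut-off factors in the definition of \<open>c\<^sub>0(\<G>)\<close> only exempt the arrows with range in \<open>B\<close>, source in
  \<open>B'\<close>, or lying in \<open>F\<close>; and a null set of arrows is one with null fibres.\<close>

lemma groupoid_c0_iff:
  "f \<in> groupoid_c0 \<G> \<longleftrightarrow> f \<in> Linfty (K \<Otimes>\<^sub>M M) \<and>
     (\<forall>\<epsilon>>0. \<exists>B\<in>sets M. \<exists>B'\<in>sets M. \<exists>F\<in>sets (K \<Otimes>\<^sub>M M).
       emeasure M B < ennreal \<epsilon> \<and> emeasure M B' < ennreal \<epsilon> \<and> emeasure (K \<Otimes>\<^sub>M M) F < \<infinity> \<and>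
       (\<forall>g\<in>carrier G. AE x in M.
          \<alpha> g x \<notin> B \<longrightarrow> x \<notin> B' \<longrightarrow> (g, x) \<notin> F \<longrightarrow> norm (f (g, x)) \<le> \<epsilon>))"
proof -
  have cut: "(norm ((1 - indicator (rng \<G> -` B) (g, x)) * (1 - indicator (src \<G> -` B') (g, x)) * f (g, x) *
        (1 - indicator F (g, x))) \<le> \<epsilon>) \<longleftrightarrow>
      (\<alpha> g x \<notin> B \<longrightarrow> x \<notin> B' \<longrightarrow> (g, x) \<notin> F \<longrightarrow> norm (f (g, x)) \<le> \<epsilon>)" if "0 < \<epsilon>" for B B' F g x \<epsilon>
    using that by (auto simp: indicator_def)
  show ?thesis
    unfolding groupoid_c0_def arrow_measure groupoid_simps(1) AE_arrows mem_Collect_eq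
    by (simp only: cut cong: imp_cong)
qed

text \<open>A local bisection is the disjoint union of the sets \<open>{t} \<times> source_slice \<theta> t\<close>. The corresponding part
  of its range, the image of \<open>source_slice \<theta> t\<close> under \<open>t\<close>, is written below as a preimage under \<open>inv t\<close>, which
  makes its measurability immediate.\<close>

definition source_slice :: "('g \<times> 'x) set \<Rightarrow> 'g \<Rightarrow> 'x set" where
  "source_slice \<theta> t = {x. (t, x) \<in> \<theta>}"

definition range_slice :: "('g \<times> 'x) set \<Rightarrow> 'g \<Rightarrow> 'x set" where
  "range_slice \<theta> t = {x \<in> space M. \<alpha> (inv t) x \<in> source_slice \<theta> t}"

lemma bisection_subset: "\<theta> \<in> local_bisections \<G> \<Longrightarrow> \<theta> \<subseteq> carrier G \<times> space M"
  using sets.sets_into_space[of \<theta> "K \<Otimes>\<^sub>M M"]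
  by (simp add: local_bisections_def space_pair_measure)

lemma slice_sets:
  assumes \<theta>: "\<theta> \<in> local_bisections \<G>" and t: "t \<in> carrier G"
  shows "source_slice \<theta> t \<in> sets M" "range_slice \<theta> t \<in> sets M"
proof -
  have "\<theta> \<in> sets (K \<Otimes>\<^sub>M M)" using \<theta> by (simp add: local_bisections_def)
  then have "Pair t -` \<theta> \<in> sets M" by (rule sets_Pair1)
  then show "source_slice \<theta> t \<in> sets M" by (simp add: source_slice_def vimage_def)
  then show "range_slice \<theta> t \<in> sets M"
    unfolding range_slice_def using t by (simp add: act_vimage_sets)
qed

lemma range_sliceE:
  assumes "x \<in> range_slice \<theta> t" "t \<in> carrier G"
  obtains y where "(t, y) \<in> \<theta>" "x = \<alpha> t y" "y = \<alpha> (inv t) x" "y \<in> space M"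
proof (rule that)
  have x: "x \<in> space M" using assms unfolding range_slice_def by simp
  show "(t, \<alpha> (inv t) x) \<in> \<theta>" using assms unfolding range_slice_def source_slice_def by simp
  show "x = \<alpha> t (\<alpha> (inv t) x)" using assms(2) x by simp
  show "\<alpha> (inv t) x \<in> space M" using act_closed[OF inv_closed[OF assms(2)] x] .
qed (rule refl)

lemma source_image: "\<theta> \<in> local_bisections \<G> \<Longrightarrow> src \<G> ` \<theta> = (\<Union>t\<in>carrier G. source_slice \<theta> t)"
  using bisection_subset[of \<theta>] by (force simp: source_slice_def)

lemma range_image:
  assumes \<theta>: "\<theta> \<in> local_bisections \<G>"
  shows "rng \<G> ` \<theta> = (\<Union>t\<in>carrier G. range_slice \<theta> t)"
proof
  show "rng \<G> ` \<theta> \<subseteq> (\<Union>t\<in>carrier G. range_slice \<theta> t)"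
  proof
    fix x assume "x \<in> rng \<G> ` \<theta>"
    then obtain t y where ty: "(t, y) \<in> \<theta>" "x = \<alpha> t y" by force
    then have "t \<in> carrier G" "y \<in> space M" using bisection_subset[OF \<theta>] by auto
    then have "x \<in> range_slice \<theta> t"
      using ty by (simp add: source_slice_def range_slice_def act_closed)
    then show "x \<in> (\<Union>t\<in>carrier G. range_slice \<theta> t)" using \<open>t \<in> carrier G\<close> by blast
  qed
  show "(\<Union>t\<in>carrier G. range_slice \<theta> t) \<subseteq> rng \<G> ` \<theta>"
  proof
    fix x assume "x \<in> (\<Union>t\<in>carrier G. range_slice \<theta> t)"
    then obtain t where "t \<in> carrier G" "x \<in> range_slice \<theta> t" by blast
    then obtain y where y: "(t, y) \<in> \<theta>" "x = \<alpha> t y" by (metis range_sliceE)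
    show "x \<in> rng \<G> ` \<theta>"
      by (rule image_eqI[OF _ y(1)]) (simp add: y(2))
  qed
qed

lemma disjoint_source_slices:
  assumes \<theta>: "\<theta> \<in> local_bisections \<G>"
  shows "disjoint_family_on (source_slice \<theta>) (carrier G)"
proof -
  have inj: "inj_on (src \<G>) \<theta>" using \<theta> by (simp add: local_bisections_def)
  have "s = t" if "(s, x) \<in> \<theta>" "(t, x) \<in> \<theta>" for s t x
    using inj_onD[OF inj _ that] by simp
  then show ?thesis
    unfolding disjoint_family_on_def source_slice_def by blast
qed

lemma disjoint_range_slices:
  assumes \<theta>: "\<theta> \<in> local_bisections \<G>"
  shows "disjoint_family_on (range_slice \<theta>) (carrier G)"
  unfolding disjoint_family_on_def
proof (intro ballI impI, rule ccontr)
  fix s t assume s: "s \<in> carrier G" and t: "t \<in> carrier G" and "s \<noteq> t"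
    and "range_slice \<theta> s \<inter> range_slice \<theta> t \<noteq> {}"
  then obtain x where "x \<in> range_slice \<theta> s" "x \<in> range_slice \<theta> t" by blast
  then obtain y z where "(s, y) \<in> \<theta>" "x = rng \<G> (s, y)" "(t, z) \<in> \<theta>" "x = rng \<G> (t, z)"
    using range_sliceE[OF _ s] range_sliceE[OF _ t] groupoid_simps(4) by metis
  moreover have "inj_on (rng \<G>) \<theta>" using \<theta> by (simp add: local_bisections_def)
  ultimately have "(s, y) = (t, z)" by (metis inj_onD)
  then show False using \<open>s \<noteq> t\<close> by simp
qed

lemma arrow_with_rng_slice:
  assumes \<theta>: "\<theta> \<in> local_bisections \<G>" and t: "t \<in> carrier G" and x: "x \<in> range_slice \<theta> t"
  shows "arrow_with_rng \<G> \<theta> x = (t, \<alpha> (inv t) x)" "x \<in> rng \<G> ` \<theta>"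
proof -
  obtain y where y: "(t, y) \<in> \<theta>" "x = \<alpha> t y" "y = \<alpha> (inv t) x"
    using x t by (rule range_sliceE)
  have inj: "inj_on (rng \<G>) \<theta>" using \<theta> by (simp add: local_bisections_def)
  show "x \<in> rng \<G> ` \<theta>"
    by (rule image_eqI[OF _ y(1)]) (simp add: y(2))
  have "arrow_with_rng \<G> \<theta> x = (t, y)"
    unfolding arrow_with_rng_def by (rule the_inv_into_f_eq[OF inj _ y(1)]) (simp add: y(2))
  then show "arrow_with_rng \<G> \<theta> x = (t, \<alpha> (inv t) x)" by (simp only: y(3))
qed

lemma right_translate_on_slice:
  assumes "\<theta> \<in> local_bisections \<G>" "t \<in> carrier G" "x \<in> range_slice \<theta> t"
  shows "right_translate \<G> \<theta> f (g, x) = f (g \<otimes> t, \<alpha> (inv t) x)"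
  using arrow_with_rng_slice[OF assms] by (simp add: right_translate_def)

lemma right_translate_off_slices:
  assumes "\<theta> \<in> local_bisections \<G>" "x \<notin> (\<Union>t\<in>carrier G. range_slice \<theta> t)"
  shows "right_translate \<G> \<theta> f (g, x) = 0"
  using assms by (simp add: right_translate_def range_image)

lemma left_translate_on_slice:
  assumes \<theta>: "\<theta> \<in> local_bisections \<G>" and t: "t \<in> carrier G" and gx: "\<alpha> g x \<in> range_slice \<theta> t"
  shows "left_translate \<G> \<theta> f (g, x) = f (inv t \<otimes> g, x)"
  using arrow_with_rng_slice[OF \<theta> t gx] by (simp add: left_translate_def)

lemma left_translate_off_slices:
  assumes "\<theta> \<in> local_bisections \<G>" "\<alpha> g x \<notin> (\<Union>t\<in>carrier G. range_slice \<theta> t)"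
  shows "left_translate \<G> \<theta> f (g, x) = 0"
  using assms by (simp add: left_translate_def range_image)

lemma constant_bisection:
  assumes t: "t \<in> carrier G"
  shows "{t} \<times> space M \<in> local_bisections \<G>"
    and "range_slice ({t} \<times> space M) t = space M"
proof -
  have "inj_on (\<alpha> t) (space M)"
    using t by (intro inj_on_inverseI[of _ "\<alpha> (inv t)"]) simp
  then have "inj_on (rng \<G>) ({t} \<times> space M)" by (auto simp: inj_on_def)
  moreover have "inj_on (src \<G>) ({t} \<times> space M)" by (auto simp: inj_on_def)
  moreover have "{t} \<times> space M \<in> sets (K \<Otimes>\<^sub>M M)" using t by (intro pair_measureI) auto
  ultimately show "{t} \<times> space M \<in> local_bisections \<G>" by (simp add: local_bisections_def)
  have slice: "source_slice ({t} \<times> space M) t = space M" by (auto simp: source_slice_def)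
  show "range_slice ({t} \<times> space M) t = space M"
    unfolding range_slice_def slice using act_closed[OF inv_closed[OF t]] by blast
qed

lemma constant_bisection_images:
  assumes t: "t \<in> carrier G"
  shows "src \<G> ` ({t} \<times> space M) = space M" "rng \<G> ` ({t} \<times> space M) = space M"
proof -
  show "src \<G> ` ({t} \<times> space M) = space M" by force
  show "rng \<G> ` ({t} \<times> space M) = space M"
  proof (intro equalityI subsetI)
    fix x assume x: "x \<in> space M"
    show "x \<in> rng \<G> ` ({t} \<times> space M)"
      by (rule image_eqI[of _ _ "(t, \<alpha> (inv t) x)"]) (use x t in \<open>simp_all add: act_closed\<close>)
  next
    fix x assume "x \<in> rng \<G> ` ({t} \<times> space M)"
    then obtain y where "y \<in> space M" "x = \<alpha> t y" by force
    then show "x \<in> space M" using act_closed[OF t] by simp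
  qed
qed


section \<open>Lifting functions from the group to the groupoid\<close>

lemma Linfty_arrows_cong:
  assumes "f \<in> Linfty (K \<Otimes>\<^sub>M M)" "\<And>g x. g \<in> carrier G \<Longrightarrow> x \<in> space M \<Longrightarrow> h (g, x) = f (g, x)"
  shows "h \<in> Linfty (K \<Otimes>\<^sub>M M)"
proof -
  have eq: "h \<gamma> = f \<gamma>" if "\<gamma> \<in> space (K \<Otimes>\<^sub>M M)" for \<gamma>
    using that assms(2) by (auto simp: space_pair_measure)
  have "h \<in> borel_measurable (K \<Otimes>\<^sub>M M)"
    using assms(1) eq measurable_cong[of "K \<Otimes>\<^sub>M M" h f borel] unfolding Linfty_def by blast
  moreover have "AE \<gamma> in K \<Otimes>\<^sub>M M. norm (h \<gamma>) \<le> C" if "AE \<gamma> in K \<Otimes>\<^sub>M M. norm (f \<gamma>) \<le> C" for C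
    using that AE_space by eventually_elim (simp add: eq)
  ultimately show ?thesis using assms(1) unfolding Linfty_def by blast
qed

lemma groupoid_c0_cong:
  assumes f: "f \<in> groupoid_c0 \<G>" and eq: "\<And>g x. g \<in> carrier G \<Longrightarrow> x \<in> space M \<Longrightarrow> h (g, x) = f (g, x)"
  shows "h \<in> groupoid_c0 \<G>"
proof -
  have "f \<in> Linfty (K \<Otimes>\<^sub>M M)" using f unfolding groupoid_c0_iff by blast
  then have "h \<in> Linfty (K \<Otimes>\<^sub>M M)" by (rule Linfty_arrows_cong) (rule eq)
  moreover have "(AE x in M. \<alpha> g x \<notin> B \<longrightarrow> x \<notin> B' \<longrightarrow> (g, x) \<notin> F \<longrightarrow> norm (h (g, x)) \<le> \<epsilon>) \<longleftrightarrow>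
      (AE x in M. \<alpha> g x \<notin> B \<longrightarrow> x \<notin> B' \<longrightarrow> (g, x) \<notin> F \<longrightarrow> norm (f (g, x)) \<le> \<epsilon>)"
    if "g \<in> carrier G" for g B B' F \<epsilon>
    using that by (intro AE_cong) (simp add: eq)
  ultimately show ?thesis
    using f unfolding groupoid_c0_iff by (simp cong: ball_cong)
qed

lemma groupoid_S_cong:
  assumes f: "f \<in> groupoid_S \<G>" and eq: "\<And>g x. g \<in> carrier G \<Longrightarrow> x \<in> space M \<Longrightarrow> h (g, x) = f (g, x)"
  shows "h \<in> groupoid_S \<G>"
proof -
  have "f \<in> Linfty (K \<Otimes>\<^sub>M M)" using f unfolding groupoid_S_def by simp
  then have "h \<in> Linfty (K \<Otimes>\<^sub>M M)" by (rule Linfty_arrows_cong) (rule eq)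
  moreover have "(\<lambda>\<gamma>. h \<gamma> * indicator (src \<G> -` (rng \<G> ` \<theta>)) \<gamma> - right_translate \<G> \<theta> h \<gamma>) \<in> groupoid_c0 \<G>"
    if \<theta>: "\<theta> \<in> local_bisections \<G>" for \<theta>
  proof (rule groupoid_c0_cong)
    show "(\<lambda>\<gamma>. f \<gamma> * indicator (src \<G> -` (rng \<G> ` \<theta>)) \<gamma> - right_translate \<G> \<theta> f \<gamma>) \<in> groupoid_c0 \<G>"
      using f \<theta> unfolding groupoid_S_def by blast
    fix g x assume g: "g \<in> carrier G" and x: "x \<in> space M"
    have "right_translate \<G> \<theta> h (g, x) = right_translate \<G> \<theta> f (g, x)"
    proof (cases "x \<in> (\<Union>t\<in>carrier G. range_slice \<theta> t)")
      case True
      then obtain t where t: "t \<in> carrier G" "x \<in> range_slice \<theta> t" by blast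
      then show ?thesis
        using g x by (simp add: right_translate_on_slice[OF \<theta> t] eq act_closed)
    qed (simp add: right_translate_off_slices[OF \<theta>])
    then show "h (g, x) * indicator (src \<G> -` (rng \<G> ` \<theta>)) (g, x) - right_translate \<G> \<theta> h (g, x) =
        f (g, x) * indicator (src \<G> -` (rng \<G> ` \<theta>)) (g, x) - right_translate \<G> \<theta> f (g, x)"
      by (simp add: eq[OF g x])
  qed
  ultimately show ?thesis unfolding groupoid_S_def by simp
qed

text \<open>The set \<open>B'\<close> of exempted sources consists of the ranges of all but finitely many slices of \<open>\<theta>\<close>. Over the
  remaining slices, \<open>f\<close> and its translate differ by \<open>f g - f (g t)\<close> with \<open>t\<close> from a finite set, so only finitely
  many \<open>g\<close>, collected in \<open>E\<close>, have to be exempted as well.\<close>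

lemma lift_in_groupoid_S:
  assumes f: "f \<in> group_S G"
  shows "(\<lambda>\<gamma>. f (fst \<gamma>)) \<in> groupoid_S \<G>"
proof -
  obtain C where C: "\<And>s. s \<in> carrier G \<Longrightarrow> norm (f s) \<le> C"
    using f unfolding group_S_iff by blast
  have C0: "0 \<le> C" using C[OF one_closed] norm_ge_zero order_trans by blast
  let ?f = "\<lambda>\<gamma>::'g \<times> 'x. f (fst \<gamma>)"
  have "(\<lambda>\<gamma>. ?f \<gamma> * indicator (src \<G> -` (rng \<G> ` \<theta>)) \<gamma> - right_translate \<G> \<theta> ?f \<gamma>) \<in> groupoid_c0 \<G>"
    (is "?h \<in> _") if \<theta>: "\<theta> \<in> local_bisections \<G>" for \<theta>
  proof -
    have on: "?h (g, x) = f g - f (g \<otimes> t)" if "t \<in> carrier G" "x \<in> range_slice \<theta> t" for g t x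
    proof -
      have "x \<in> rng \<G> ` \<theta>" using that by (simp only: range_image[OF \<theta>]) blast
      then show ?thesis using right_translate_on_slice[OF \<theta> that, of ?f] by simp
    qed
    have off: "?h (g, x) = 0" if "x \<notin> (\<Union>t\<in>carrier G. range_slice \<theta> t)" for g x
    proof -
      have "x \<notin> rng \<G> ` \<theta>" using that by (simp only: range_image[OF \<theta>]) blast
      then show ?thesis using right_translate_off_slices[OF \<theta> that, of ?f] by simp
    qed
    have "?h \<in> Linfty (K \<Otimes>\<^sub>M M)"
      unfolding Linfty_arrows
    proof (intro conjI ballI exI)
      fix g assume g: "g \<in> carrier G"
      show "(\<lambda>x. ?h (g, x)) \<in> borel_measurable M"
        by (rule measurable_countable_pieces[OF countable_G slice_sets(2)[OF \<theta>],
            where F = "\<lambda>t _. f g - f (g \<otimes> t)" and c = 0])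
          (use on off in auto)
      have "norm (?h (g, x)) \<le> 2 * C" for x
      proof (cases "x \<in> (\<Union>t\<in>carrier G. range_slice \<theta> t)")
        case True
        then obtain t where t: "t \<in> carrier G" "x \<in> range_slice \<theta> t" by blast
        then show ?thesis
          unfolding on[OF t]
          using C[OF g] C[OF m_closed[OF g t(1)]] norm_triangle_ineq4[of "f g" "f (g \<otimes> t)"]
          by linarith
      qed (use off C0 in simp)
      then show "AE x in M. norm (?h (g, x)) \<le> 2 * C" by simp
    qed
    moreover have "\<exists>B\<in>sets M. \<exists>B'\<in>sets M. \<exists>F\<in>sets (K \<Otimes>\<^sub>M M).
       emeasure M B < ennreal \<epsilon> \<and> emeasure M B' < ennreal \<epsilon> \<and> emeasure (K \<Otimes>\<^sub>M M) F < \<infinity> \<and>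
       (\<forall>g\<in>carrier G. AE x in M.
          \<alpha> g x \<notin> B \<longrightarrow> x \<notin> B' \<longrightarrow> (g, x) \<notin> F \<longrightarrow> norm (?h (g, x)) \<le> \<epsilon>)" if \<epsilon>: "\<epsilon> > 0" for \<epsilon>
    proof -
      obtain T where T: "finite T" "T \<subseteq> carrier G"
          "measure M (\<Union>t\<in>carrier G - T. range_slice \<theta> t) < \<epsilon>"
        using M.disjoint_family_small_tail[OF countable_G slice_sets(2)[OF \<theta>] disjoint_range_slices[OF \<theta>] \<epsilon>]
        by blast
      define B' where "B' = (\<Union>t\<in>carrier G - T. range_slice \<theta> t)"
      define E where "E = (\<Union>t\<in>T. {s \<in> carrier G. \<epsilon> \<le> norm (f s - f (s \<otimes> t))})"
      have E: "finite E" "E \<subseteq> carrier G"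
        using f T \<epsilon> unfolding E_def group_S_iff group_c0_def by auto
      have B': "B' \<in> sets M"
        unfolding B'_def using slice_sets(2)[OF \<theta>] countable_G by (intro sets.countable_UN') auto
      have small: "norm (?h (g, x)) \<le> \<epsilon>"
        if g: "g \<in> carrier G" and x: "x \<notin> B'" "g \<notin> E" for g x
      proof (cases "x \<in> (\<Union>t\<in>carrier G. range_slice \<theta> t)")
        case True
        then obtain t where t: "t \<in> carrier G" "x \<in> range_slice \<theta> t" "t \<in> T"
          using x(1) unfolding B'_def by blast
        then have "norm (f g - f (g \<otimes> t)) < \<epsilon>"
          using x(2) g unfolding E_def by (auto simp: not_le)
        then show ?thesis unfolding on[OF t(1,2)] by simp
      next
        case False
        then show ?thesis unfolding off[OF False] using \<epsilon> by simp
      qed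
      show ?thesis
      proof (intro bexI conjI)
        show "emeasure M {} < ennreal \<epsilon>" using \<epsilon> by simp
        show "emeasure M B' < ennreal \<epsilon>"
          using T(3) \<epsilon> by (simp add: B'_def M.emeasure_eq_measure ennreal_less_iff)
        show "E \<times> space M \<in> sets (K \<Otimes>\<^sub>M M)" using E by (intro pair_measureI) auto
        show "emeasure (K \<Otimes>\<^sub>M M) (E \<times> space M) < \<infinity>"
          using E by (simp add: M.emeasure_pair_measure_Times M.emeasure_space_1 ennreal_of_nat_eq_real_of_nat)
        show "\<forall>g\<in>carrier G. AE x in M.
            \<alpha> g x \<notin> {} \<longrightarrow> x \<notin> B' \<longrightarrow> (g, x) \<notin> E \<times> space M \<longrightarrow> norm (?h (g, x)) \<le> \<epsilon>"
          using small by (intro ballI AE_I2) blast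
      qed (use B' in auto)
    qed
    ultimately show ?thesis unfolding groupoid_c0_iff by blast
  qed
  moreover have "?f \<in> Linfty (K \<Otimes>\<^sub>M M)"
    unfolding Linfty_arrows using C by auto
  ultimately show ?thesis unfolding groupoid_S_def by simp
qed

text \<open>The bisection \<open>{t} \<times> X\<close> has full source and range and translates lifts by \<open>t\<close>, so invariance under it is
  invariance under \<open>t\<close>.\<close>

lemma state_pullback_lift:
  assumes \<phi>: "left_invariant_state \<G> \<phi>"
  shows "state_on K (group_S G) (\<lambda>f. \<phi> (\<lambda>\<gamma>. f (fst \<gamma>)))"
    and "t \<in> carrier G \<Longrightarrow> f \<in> group_S G \<Longrightarrow>
      \<phi> (\<lambda>\<gamma>. f (inv t \<otimes> fst \<gamma>)) = \<phi> (\<lambda>\<gamma>. f (fst \<gamma>))"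
proof -
  have st: "state_on (K \<Otimes>\<^sub>M M) (groupoid_S \<G>) \<phi>"
    using \<phi> unfolding left_invariant_state_def by simp
  show "state_on K (group_S G) (\<lambda>f. \<phi> (\<lambda>\<gamma>. f (fst \<gamma>)))"
    using st lift_in_groupoid_S unfolding state_on_def
    by (simp add: AE_count_space AE_arrows)
  assume t: "t \<in> carrier G" and f: "f \<in> group_S G"
  let ?\<theta> = "{t} \<times> space M" and ?f = "\<lambda>\<gamma>::'g \<times> 'x. f (fst \<gamma>)" and ?ft = "\<lambda>\<gamma>::'g \<times> 'x. f (inv t \<otimes> fst \<gamma>)"
  let ?u = "\<lambda>\<gamma>. ?f \<gamma> * indicator (rng \<G> -` (src \<G> ` ?\<theta>)) \<gamma> - left_translate \<G> ?\<theta> ?f \<gamma>"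
  let ?v = "\<lambda>\<gamma>. ?f \<gamma> - ?ft \<gamma>"
  note ft = group_S_translate[OF f t]
  have v: "?v \<in> groupoid_S \<G>"
    by (rule lift_in_groupoid_S[OF group_S_diff[OF f ft]])
  have eq: "?u (g, x) = ?v (g, x)" if g: "g \<in> carrier G" and x: "x \<in> space M" for g x
  proof -
    have "\<alpha> g x \<in> space M" using g x by (rule act_closed)
    then show ?thesis
      using left_translate_on_slice[OF constant_bisection(1)[OF t] t, of g x ?f]
      by (simp add: constant_bisection(2)[OF t] constant_bisection_images(1)[OF t])
  qed
  have zero: "(\<lambda>\<gamma>. 0) \<in> groupoid_S \<G>"
    using lift_in_groupoid_S[OF const_in_group_S[of 0]] by simp
  \<comment> \<open>The two functions agree at the arrows of the groupoid, but need not at the other points of the type.\<close>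
  have "\<phi> ?u = \<phi> ?v"
  proof (rule state_on_cong[OF st _ v])
    show "?u \<in> groupoid_S \<G>" using v eq by (rule groupoid_S_cong)
    show "(\<lambda>\<gamma>. ?u \<gamma> - ?v \<gamma>) \<in> groupoid_S \<G>" "(\<lambda>\<gamma>. ?v \<gamma> - ?u \<gamma>) \<in> groupoid_S \<G>"
      using eq by (auto intro!: groupoid_S_cong[OF zero])
    show "AE \<gamma> in K \<Otimes>\<^sub>M M. ?u \<gamma> = ?v \<gamma>"
      by (rule AE_I2) (use eq in \<open>auto simp only: space_pair_measure space_count_space\<close>)
  qed
  moreover have "\<phi> ?u = 0"
    using \<phi>[unfolded left_invariant_state_def, THEN conjunct2, THEN bspec, OF lift_in_groupoid_S[OF f],
        THEN bspec, OF constant_bisection(1)[OF t]] .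
  moreover have "\<phi> (\<lambda>\<gamma>. ?v \<gamma> + ?ft \<gamma>) = \<phi> ?v + \<phi> ?ft"
    using st[unfolded state_on_def, THEN conjunct1, THEN bspec, OF v, THEN bspec, OF lift_in_groupoid_S[OF ft]] .
  ultimately show "\<phi> ?ft = \<phi> ?f" by simp
qed


section \<open>Averaging functions on the groupoid over the fibres\<close>

definition fibre_mean :: "('g \<times> 'x \<Rightarrow> complex) \<Rightarrow> 'g \<Rightarrow> complex" where
  "fibre_mean f g = (\<integral>x. f (g, x) \<partial>M)"

lemma Linfty_arrows_slice:
  assumes "f \<in> Linfty (K \<Otimes>\<^sub>M M)" "g \<in> carrier G"
  shows "(\<lambda>x. f (g, x)) \<in> Linfty M"
  using assms unfolding Linfty_arrows by (auto simp: Linfty_def)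

lemma Linfty_arrows_bound:
  assumes "f \<in> Linfty (K \<Otimes>\<^sub>M M)"
  obtains C where "0 \<le> C" "\<And>g. g \<in> carrier G \<Longrightarrow> AE x in M. norm (f (g, x)) \<le> C"
proof -
  obtain C where C: "\<And>g. g \<in> carrier G \<Longrightarrow> AE x in M. norm (f (g, x)) \<le> C"
    using assms unfolding Linfty_arrows by blast
  have "AE x in M. norm (f (g, x)) \<le> \<bar>C\<bar>" if "g \<in> carrier G" for g
    using C[OF that] by eventually_elim simp
  then show ?thesis using that[of "\<bar>C\<bar>"] by simp
qed

text \<open>The measures of the fibres of \<open>F\<close> sum to the measure of \<open>F\<close>, so this is Markov's inequality for the
  counting measure on the group.\<close>

lemma finite_large_fibres:
  assumes F: "F \<in> sets (K \<Otimes>\<^sub>M M)" "emeasure (K \<Otimes>\<^sub>M M) F < \<infinity>" and \<delta>: "\<delta> > 0"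
  shows "finite {g \<in> carrier G. \<delta> \<le> measure M (Pair g -` F)}" (is "finite ?E")
proof -
  let ?u = "\<lambda>g. emeasure M (Pair g -` F)"
  have total: "(\<integral>\<^sup>+g. ?u g * indicator (carrier G) g \<partial>K) = emeasure (K \<Otimes>\<^sub>M M) F"
    unfolding M.emeasure_pair_measure_alt[OF F(1)] by (intro nn_integral_cong) auto
  have "?E \<subseteq> {g \<in> carrier G. 1 \<le> ennreal (1 / \<delta>) * ?u g}"
  proof
    fix g assume g: "g \<in> ?E"
    then have "1 \<le> 1 / \<delta> * measure M (Pair g -` F)" using \<delta> by (simp add: field_simps)
    then have "ennreal 1 \<le> ennreal (1 / \<delta> * measure M (Pair g -` F))" by (rule ennreal_leI)
    then show "g \<in> {g \<in> carrier G. 1 \<le> ennreal (1 / \<delta>) * ?u g}"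
      using g \<delta> by (simp add: M.emeasure_eq_measure ennreal_mult[symmetric])
  qed
  then have "emeasure K ?E \<le> emeasure K {g \<in> carrier G. 1 \<le> ennreal (1 / \<delta>) * ?u g}"
    by (intro emeasure_mono) auto
  also have "\<dots> \<le> ennreal (1 / \<delta>) * emeasure (K \<Otimes>\<^sub>M M) F"
    unfolding total[symmetric] by (intro nn_integral_Markov_inequality) auto
  also have "\<dots> < \<infinity>" using F(2) by (simp add: ennreal_mult_less_top)
  finally show ?thesis
    by (cases "finite ?E") (auto simp: emeasure_count_space_infinite)
qed

text \<open>In the fibre over \<open>g\<close>, the function \<open>h\<close> is at most \<open>\<delta>\<close> off the sets \<open>g\<^sup>-\<^sup>1 B\<close>, \<open>B'\<close> and the fibre of
  \<open>F\<close>. The first two have measure below \<open>\<delta>\<close> for every \<open>g\<close>, by invariance of the measure, and the third for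
  all but finitely many \<open>g\<close>. Only the size of \<open>h\<close> enters, hence the formulation for a dominated \<open>k\<close>.\<close>

lemma fibre_mean_in_group_c0:
  assumes h: "h \<in> groupoid_c0 \<G>"
    and k: "\<And>g. g \<in> carrier G \<Longrightarrow> (\<lambda>x. k (g, x)) \<in> borel_measurable M"
      "\<And>g. g \<in> carrier G \<Longrightarrow> AE x in M. norm (k (g, x)) \<le> norm (h (g, x))"
  shows "fibre_mean k \<in> group_c0 G"
  unfolding group_c0_def
proof (intro CollectI allI impI)
  fix \<epsilon> :: real assume \<epsilon>: "\<epsilon> > 0"
  have "h \<in> Linfty (K \<Otimes>\<^sub>M M)" using h unfolding groupoid_c0_def by simp
  then obtain C where C: "0 \<le> C" "\<And>g. g \<in> carrier G \<Longrightarrow> AE x in M. norm (h (g, x)) \<le> C"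
    using Linfty_arrows_bound by metis
  \<comment> \<open>The mean is at most \<open>\<delta>\<close> plus \<open>C\<close> times the measure of the three exceptional sets.\<close>
  define \<delta> where "\<delta> = \<epsilon> / (2 * (1 + 3 * C))"
  have \<delta>: "\<delta> > 0" "\<delta> + C * (\<delta> + \<delta> + \<delta>) < \<epsilon>"
  proof -
    show "\<delta> > 0" using \<epsilon> C(1) by (simp add: \<delta>_def)
    have "\<delta> * (2 * (1 + 3 * C)) = \<epsilon>" using C(1) unfolding \<delta>_def by simp
    then have "\<delta> + C * (\<delta> + \<delta> + \<delta>) = \<epsilon> / 2" by (simp add: algebra_simps)
    then show "\<delta> + C * (\<delta> + \<delta> + \<delta>) < \<epsilon>" using \<epsilon> by simp
  qed
  obtain B B' F where B: "B \<in> sets M" "emeasure M B < ennreal \<delta>"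
      and B': "B' \<in> sets M" "emeasure M B' < ennreal \<delta>"
      and F: "F \<in> sets (K \<Otimes>\<^sub>M M)" "emeasure (K \<Otimes>\<^sub>M M) F < \<infinity>"
      and small: "\<And>g. g \<in> carrier G \<Longrightarrow>
        AE x in M. \<alpha> g x \<notin> B \<longrightarrow> x \<notin> B' \<longrightarrow> (g, x) \<notin> F \<longrightarrow> norm (h (g, x)) \<le> \<delta>"
    using h \<delta>(1) unfolding groupoid_c0_iff by meson
  show "finite {g \<in> carrier G. \<epsilon> \<le> norm (fibre_mean k g)}"
  proof (rule finite_subset[OF _ finite_large_fibres[OF F \<delta>(1)]], rule subsetI, rule ccontr)
    fix g assume "g \<in> {g \<in> carrier G. \<epsilon> \<le> norm (fibre_mean k g)}"
      and "g \<notin> {g \<in> carrier G. \<delta> \<le> measure M (Pair g -` F)}"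
    then have g: "g \<in> carrier G" and large: "\<epsilon> \<le> norm (fibre_mean k g)"
      and Fg: "measure M (Pair g -` F) < \<delta>" by auto
    let ?B = "{x \<in> space M. \<alpha> g x \<in> B}" and ?F = "Pair g -` F"
    have sets: "?B \<in> sets M" "?F \<in> sets M"
      using act_vimage_sets[OF g B(1)] F(1) by (auto intro: sets_Pair1)
    have meas: "measure M ?B < \<delta>" "measure M B' < \<delta>"
      using measure_act_vimage[OF g B(1)] B(2) B'(2) \<delta>(1)
      by (simp_all add: M.emeasure_eq_measure ennreal_less_iff)
    have int_k: "integrable M (\<lambda>x. k (g, x))"
    proof (rule M.integrable_const_bound[OF _ k(1)[OF g]])
      show "AE x in M. norm (k (g, x)) \<le> C"
        using k(2)[OF g] C(2)[OF g] by eventually_elim simp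
    qed
    have "norm (fibre_mean k g) \<le> (\<integral>x. norm (k (g, x)) \<partial>M)"
      unfolding fibre_mean_def by (rule integral_norm_bound)
    also have "\<dots> \<le> (\<integral>x. \<delta> + C * (indicator ?B x + indicator B' x + indicator ?F x) \<partial>M)"
    proof (rule integral_mono_AE)
      show "integrable M (\<lambda>x. norm (k (g, x)))" using int_k by simp
      show "integrable M (\<lambda>x. \<delta> + C * (indicator ?B x + indicator B' x + indicator ?F x))"
        using sets B'(1) by (simp add: M.integrable_indicator_real)
      show "AE x in M. norm (k (g, x)) \<le> \<delta> + C * (indicator ?B x + indicator B' x + indicator ?F x)"
        using small[OF g] k(2)[OF g] C(2)[OF g] AE_space
      proof eventually_elim
        case (elim x)
        show ?case
        proof (cases "x \<in> ?B \<or> x \<in> B' \<or> x \<in> ?F")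
          case True
          then have "1 \<le> indicator ?B x + indicator B' x + (indicator ?F x :: real)"
            by (auto simp: indicator_def)
          then have "C * 1 \<le> C * (indicator ?B x + indicator B' x + indicator ?F x)"
            using C(1) by (rule mult_left_mono)
          then show ?thesis using elim \<delta>(1) by linarith
        next
          case False
          then have "norm (h (g, x)) \<le> \<delta>" using elim(1,4) by simp
          then show ?thesis using elim(2) False by simp
        qed
      qed
    qed
    also have "\<dots> = \<delta> + C * (measure M ?B + measure M B' + measure M ?F)"
      using sets B'(1) by (simp add: M.integrable_indicator_real M.prob_space)
    also have "\<dots> \<le> \<delta> + C * (\<delta> + \<delta> + \<delta>)"
      using meas Fg C(1) by (intro add_left_mono mult_left_mono add_mono) auto
    finally show False using large \<delta>(2) by simp
  qed
qed

text \<open>Substituting \<open>x \<mapsto> t\<^sup>-\<^sup>1 x\<close> in the mean over the fibre of \<open>s t\<close> turns it into the mean of the right translate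
  of \<open>f\<close> by \<open>{t} \<times> X\<close> over the fibre of \<open>s\<close>. The substitution fixes the range \<open>s x\<close> of the arrow, so the
  weight \<open>indicator A \<circ> r\<close> is unaffected; it is the weight needed to isolate one slice of a bisection.\<close>

lemma fibre_mean_in_group_S:
  assumes f: "f \<in> groupoid_S \<G>" and A: "A \<in> sets M"
  shows "fibre_mean (\<lambda>\<gamma>. f \<gamma> * indicator A (rng \<G> \<gamma>)) \<in> group_S G"
proof -
  let ?fA = "\<lambda>\<gamma>. f \<gamma> * indicator A (rng \<G> \<gamma>)"
  have f_Linf: "f \<in> Linfty (K \<Otimes>\<^sub>M M)" using f unfolding groupoid_S_def by simp
  have f_meas: "(\<lambda>x. f (g, x)) \<in> borel_measurable M" if "g \<in> carrier G" for g
    using f_Linf that unfolding Linfty_arrows by blast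
  have A_meas: "(\<lambda>x. indicator A (\<alpha> g x) :: complex) \<in> borel_measurable M" if "g \<in> carrier G" for g
    using measurable_compose[OF act_measurable[OF that] borel_measurable_indicator[OF A]] .
  obtain C where C: "0 \<le> C" "\<And>g. g \<in> carrier G \<Longrightarrow> AE x in M. norm (f (g, x)) \<le> C"
    using Linfty_arrows_bound[OF f_Linf] by metis
  have fA_bound: "AE x in M. norm (?fA (g, x)) \<le> C" if "g \<in> carrier G" for g
    using C(2)[OF that] by eventually_elim (auto simp: indicator_def C(1))
  have fA_meas: "(\<lambda>x. ?fA (g, x)) \<in> borel_measurable M" if "g \<in> carrier G" for g
    using f_meas[OF that] A_meas[OF that] by simp
  have fA_int: "integrable M (\<lambda>x. ?fA (g, x))" if "g \<in> carrier G" for g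
    using fA_bound[OF that] fA_meas[OF that] by (rule M.integrable_const_bound)
  have "norm (fibre_mean ?fA g) \<le> C" if g: "g \<in> carrier G" for g
  proof -
    have "norm (fibre_mean ?fA g) \<le> (\<integral>x. norm (?fA (g, x)) \<partial>M)"
      unfolding fibre_mean_def by (rule integral_norm_bound)
    also have "\<dots> \<le> (\<integral>x. C \<partial>M)"
      using fA_int[OF g] fA_bound[OF g] by (intro integral_mono_AE) auto
    finally show ?thesis by (simp add: M.prob_space)
  qed
  moreover have "(\<lambda>s. fibre_mean ?fA s - fibre_mean ?fA (s \<otimes> t)) \<in> group_c0 G"
    if t: "t \<in> carrier G" for t
  proof -
    let ?\<theta> = "{t} \<times> space M"
    let ?k = "\<lambda>(s, x). (f (s, x) - f (s \<otimes> t, \<alpha> (inv t) x)) * indicator A (\<alpha> s x)"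
    let ?h = "\<lambda>\<gamma>. f \<gamma> * indicator (src \<G> -` (rng \<G> ` ?\<theta>)) \<gamma> - right_translate \<G> ?\<theta> f \<gamma>"
    have shift_meas: "(\<lambda>x. f (s \<otimes> t, \<alpha> (inv t) x)) \<in> borel_measurable M" if s: "s \<in> carrier G" for s
      using measurable_compose[OF act_measurable f_meas, of "inv t" "s \<otimes> t"] s t by simp
    have mean_k: "fibre_mean ?fA s - fibre_mean ?fA (s \<otimes> t) = fibre_mean ?k s" if s: "s \<in> carrier G" for s
    proof -
      have st: "s \<otimes> t \<in> carrier G" using s t by simp
      have shift: "?fA (s \<otimes> t, \<alpha> (inv t) x) = f (s \<otimes> t, \<alpha> (inv t) x) * indicator A (\<alpha> s x)"
        if x: "x \<in> space M" for x
        using x s t by (simp add: act_mult act_closed)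
      have "fibre_mean ?fA (s \<otimes> t) = (\<integral>x. ?fA (s \<otimes> t, \<alpha> (inv t) x) \<partial>M)"
        unfolding fibre_mean_def using integral_act[OF inv_closed[OF t] fA_meas[OF st]] by simp
      also have "\<dots> = (\<integral>x. f (s \<otimes> t, \<alpha> (inv t) x) * indicator A (\<alpha> s x) \<partial>M)"
        by (rule Bochner_Integration.integral_cong[OF refl shift])
      finally have *: "fibre_mean ?fA (s \<otimes> t) = (\<integral>x. f (s \<otimes> t, \<alpha> (inv t) x) * indicator A (\<alpha> s x) \<partial>M)" .
      have "integrable M (\<lambda>x. f (s \<otimes> t, \<alpha> (inv t) x) * indicator A (\<alpha> s x))"
      proof (rule M.integrable_const_bound)
        show "AE x in M. norm (f (s \<otimes> t, \<alpha> (inv t) x) * indicator A (\<alpha> s x)) \<le> C"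
          using act_AE[OF inv_closed[OF t] C(2)[OF st]]
          by eventually_elim (auto simp: indicator_def C(1))
      qed (use shift_meas[OF s] A_meas[OF s] in simp)
      then show ?thesis
        unfolding * using fA_int[OF s]
        by (simp add: fibre_mean_def left_diff_distrib)
    qed
    have k_c0: "fibre_mean ?k \<in> group_c0 G"
    proof (rule fibre_mean_in_group_c0)
      show "?h \<in> groupoid_c0 \<G>"
        using f constant_bisection(1)[OF t] unfolding groupoid_S_def by blast
      fix s assume s: "s \<in> carrier G"
      show "(\<lambda>x. ?k (s, x)) \<in> borel_measurable M"
        using f_meas[OF s] shift_meas[OF s] A_meas[OF s] by simp
      have "?h (s, x) = f (s, x) - f (s \<otimes> t, \<alpha> (inv t) x)" if "x \<in> space M" for x
        using that right_translate_on_slice[OF constant_bisection(1)[OF t] t, of x f s]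
        by (simp add: constant_bisection(2)[OF t] constant_bisection_images(2)[OF t])
      then show "AE x in M. norm (?k (s, x)) \<le> norm (?h (s, x))"
        by (intro AE_I2) (simp add: indicator_def)
    qed
    show ?thesis
      by (rule group_c0_dominated[OF k_c0 k_c0, where C = 1]) (simp only: mean_k, simp)
  qed
  ultimately show ?thesis unfolding group_S_iff by blast
qed

lemma fibre_mean_groupoid_S:
  assumes f: "f \<in> groupoid_S \<G>"
  shows "fibre_mean f \<in> group_S G"
proof (rule group_S_cong[OF fibre_mean_in_group_S[OF f sets.top]])
  fix g assume g: "g \<in> carrier G"
  show "fibre_mean f g = fibre_mean (\<lambda>\<gamma>. f \<gamma> * indicator (space M) (rng \<G> \<gamma>)) g"
    unfolding fibre_mean_def
    by (rule Bochner_Integration.integral_cong) (use g in \<open>auto simp: act_closed\<close>)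
qed

lemma fibre_mean_state:
  assumes \<phi>: "state_on K (group_S G) \<phi>"
  shows "state_on (K \<Otimes>\<^sub>M M) (groupoid_S \<G>) (\<lambda>f. \<phi> (fibre_mean f))"
proof -
  note linear = group_state_linear[OF \<phi>] and cong = group_state_cong[OF \<phi>]
  have int: "integrable M (\<lambda>x. f (g, x))" if "f \<in> groupoid_S \<G>" "g \<in> carrier G" for f g
    using that Linfty_arrows_slice[of f g] by (intro M.Linfty_integrable) (auto simp: groupoid_S_def)
  have "\<phi> (fibre_mean (\<lambda>x. f x + g x)) = \<phi> (fibre_mean f) + \<phi> (fibre_mean g)"
    if f: "f \<in> groupoid_S \<G>" and g: "g \<in> groupoid_S \<G>" for f g
  proof -
    note S = fibre_mean_groupoid_S[OF f] fibre_mean_groupoid_S[OF g]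
    \<comment> \<open>Off the carrier a fibre need not be integrable, so the mean is additive only on the carrier.\<close>
    have "\<phi> (fibre_mean (\<lambda>x. f x + g x)) = \<phi> (\<lambda>s. fibre_mean f s + fibre_mean g s)"
      by (rule cong[OF group_S_add[OF S]]) (simp add: fibre_mean_def int f g)
    then show ?thesis using linear(1)[OF S] by simp
  qed
  moreover have "\<phi> (fibre_mean (\<lambda>x. c * f x)) = c * \<phi> (fibre_mean f)" if f: "f \<in> groupoid_S \<G>" for c f
    using linear(2)[OF fibre_mean_groupoid_S[OF f] fibre_mean_groupoid_S[OF f], of c]
    by (simp add: fibre_mean_def[abs_def])
  moreover have "\<phi> (fibre_mean f) \<in> \<real>\<^sub>\<ge>\<^sub>0"
    if f: "f \<in> groupoid_S \<G>" and pos: "AE \<gamma> in K \<Otimes>\<^sub>M M. f \<gamma> \<in> \<real>\<^sub>\<ge>\<^sub>0" for f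
  proof -
    have "fibre_mean f g \<in> \<real>\<^sub>\<ge>\<^sub>0" if g: "g \<in> carrier G" for g
    proof -
      have AE: "AE x in M. f (g, x) \<in> \<real>\<^sub>\<ge>\<^sub>0" using pos g unfolding AE_arrows by blast
      have "Re (fibre_mean f g) = (\<integral>x. Re (f (g, x)) \<partial>M)" "Im (fibre_mean f g) = (\<integral>x. Im (f (g, x)) \<partial>M)"
        unfolding fibre_mean_def using int[OF f g] by simp_all
      moreover have "0 \<le> (\<integral>x. Re (f (g, x)) \<partial>M)"
        by (rule integral_nonneg_AE) (use AE in eventually_elim, simp add: complex_nonneg_Reals_iff)
      moreover have "(\<integral>x. Im (f (g, x)) \<partial>M) = 0"
        by (rule integral_eq_zero_AE) (use AE in eventually_elim, simp add: complex_nonneg_Reals_iff)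
      ultimately show ?thesis by (simp add: complex_nonneg_Reals_iff)
    qed
    then show ?thesis
      using \<phi> fibre_mean_groupoid_S[OF f] unfolding state_on_def by (simp add: AE_count_space)
  qed
  moreover have "\<phi> (fibre_mean (\<lambda>x. 1)) = 1"
    using \<phi> by (simp add: fibre_mean_def[abs_def] M.prob_space state_on_def)
  ultimately show ?thesis unfolding state_on_def by blast
qed

text \<open>The substitution \<open>x \<mapsto> g x\<close> shows that \<open>f \<circ> r\<close> has the same mean \<open>\<integral> f\<close> over every fibre.\<close>

lemma fibre_mean_normal:
  assumes \<phi>: "state_on K (group_S G) \<phi>"
  shows "normal_functional M (\<lambda>f. \<phi> (fibre_mean (\<lambda>\<gamma>. f (rng \<G> \<gamma>))))"
proof -
  have on_units: "\<phi> (fibre_mean (\<lambda>\<gamma>. complex_of_real (f (rng \<G> \<gamma>)))) = complex_of_real (integral\<^sup>L M f)"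
    if f: "f \<in> Linfty M" for f :: "'x \<Rightarrow> real"
  proof -
    have meas: "f \<in> borel_measurable M" using f unfolding Linfty_def by blast
    have "\<phi> (fibre_mean (\<lambda>\<gamma>. complex_of_real (f (rng \<G> \<gamma>)))) = \<phi> (\<lambda>s. complex_of_real (integral\<^sup>L M f))"
      by (rule group_state_cong[OF \<phi> const_in_group_S])
        (simp add: fibre_mean_def integral_act[OF _ meas])
    then show ?thesis
      using group_state_linear(4)[OF \<phi> const_in_group_S const_in_group_S] by simp
  qed
  show ?thesis
    unfolding normal_functional_def
  proof (intro allI impI)
    fix D F and \<epsilon> :: real
    assume D: "D \<noteq> {}" "D \<subseteq> Linfty M"
      and dir: "\<forall>f\<in>D. \<forall>g\<in>D. \<exists>h\<in>D. (AE x in M. f x \<le> h x) \<and> (AE x in M. g x \<le> h x)"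
      and lub: "Linfty_lub M D F" and \<epsilon>: "0 < \<epsilon>"
    obtain f where f: "f \<in> D" "integral\<^sup>L M F - integral\<^sup>L M f < \<epsilon>"
      using M.integral_Linfty_lub_approx[OF D dir lub \<epsilon>] by blast
    have F: "F \<in> Linfty M" and upper: "\<And>g. g \<in> D \<Longrightarrow> AE x in M. g x \<le> F x"
      using lub unfolding Linfty_lub_def by blast+
    have "norm (\<phi> (fibre_mean (\<lambda>\<gamma>. complex_of_real (g (rng \<G> \<gamma>)))) -
        \<phi> (fibre_mean (\<lambda>\<gamma>. complex_of_real (F (rng \<G> \<gamma>))))) < \<epsilon>"
      if g: "g \<in> D" and fg: "AE x in M. f x \<le> g x" for g
    proof -
      have int: "integrable M h" if "h \<in> D \<or> h = F" for h
        using that D(2) F M.Linfty_integrable by blast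
      have "integral\<^sup>L M f \<le> integral\<^sup>L M g" "integral\<^sup>L M g \<le> integral\<^sup>L M F"
        using integral_mono_AE[OF _ _ fg] integral_mono_AE[OF _ _ upper[OF g]] int f(1) g by blast+
      moreover have "g \<in> Linfty M" using g D(2) by blast
      ultimately show ?thesis
        using f(2) by (simp add: on_units F of_real_diff[symmetric] del: of_real_diff)
    qed
    then show "\<exists>f\<in>D. \<forall>g\<in>D. (AE x in M. f x \<le> g x) \<longrightarrow>
        norm (\<phi> (fibre_mean (\<lambda>\<gamma>. complex_of_real (g (rng \<G> \<gamma>)))) -
          \<phi> (fibre_mean (\<lambda>\<gamma>. complex_of_real (F (rng \<G> \<gamma>))))) < \<epsilon>"
      using f(1) by blast
  qed
qed

text \<open>With \<open>m t\<close> the mean of the part of \<open>f\<close> whose range lies in the source slice \<open>A t\<close>, the slice \<open>{t} \<times> A t\<close>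
  of \<open>\<theta>\<close> contributes \<open>w t = m t - L\<^sub>t (m t)\<close>, which the invariant state \<open>\<phi>\<close> annihilates. Outside a finite set \<open>T\<close>
  of slices, what remains is supported on the arrows with range in \<open>A'\<close> or \<open>R'\<close>, the unions of the other source
  and range slices. By invariance of the measure these arrows have the same small measure in the fibre over
  every \<open>g\<close>, so the remainder has uniformly small means.\<close>

lemma fibre_mean_left_invariant:
  assumes \<phi>: "state_on K (group_S G) \<phi>"
    and inv: "\<And>t f. t \<in> carrier G \<Longrightarrow> f \<in> group_S G \<Longrightarrow> \<phi> (\<lambda>s. f (inv t \<otimes> s)) = \<phi> f"
    and f: "f \<in> groupoid_S \<G>" and \<theta>: "\<theta> \<in> local_bisections \<G>"
  shows "\<phi> (fibre_mean (\<lambda>\<gamma>. f \<gamma> * indicator (rng \<G> -` (src \<G> ` \<theta>)) \<gamma> - left_translate \<G> \<theta> f \<gamma>)) = 0"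
    (is "\<phi> (fibre_mean ?u) = 0")
proof (rule group_state_null_limit[OF \<phi>])
  fix \<epsilon> :: real assume \<epsilon>: "\<epsilon> > 0"
  have f_Linf: "f \<in> Linfty (K \<Otimes>\<^sub>M M)" using f unfolding groupoid_S_def by simp
  have f_meas: "(\<lambda>x. f (g, x)) \<in> borel_measurable M" if "g \<in> carrier G" for g
    using f_Linf that unfolding Linfty_arrows by blast
  obtain C where C: "0 \<le> C" "\<And>g. g \<in> carrier G \<Longrightarrow> AE x in M. norm (f (g, x)) \<le> C"
    using Linfty_arrows_bound[OF f_Linf] by metis
  define \<delta> where "\<delta> = \<epsilon> / (2 * (C + 1))"
  have \<delta>: "\<delta> > 0" "C * (\<delta> + \<delta>) \<le> \<epsilon>"
  proof -
    show "\<delta> > 0" using \<epsilon> C(1) by (simp add: \<delta>_def)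
    moreover have "\<delta> * (2 * (C + 1)) = \<epsilon>" using C(1) unfolding \<delta>_def by simp
    ultimately show "C * (\<delta> + \<delta>) \<le> \<epsilon>" by (simp add: algebra_simps)
  qed
  let ?A = "source_slice \<theta>" and ?R = "range_slice \<theta>"
  note A_sets = slice_sets(1)[OF \<theta>] and R_sets = slice_sets(2)[OF \<theta>]
  obtain T1 where T1: "finite T1" "T1 \<subseteq> carrier G" "measure M (\<Union>t\<in>carrier G - T1. ?A t) < \<delta>"
    using M.disjoint_family_small_tail[OF countable_G A_sets disjoint_source_slices[OF \<theta>] \<delta>(1)] by blast
  obtain T2 where T2: "finite T2" "T2 \<subseteq> carrier G" "measure M (\<Union>t\<in>carrier G - T2. ?R t) < \<delta>"
    using M.disjoint_family_small_tail[OF countable_G R_sets disjoint_range_slices[OF \<theta>] \<delta>(1)] by blast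
  define T where "T = T1 \<union> T2"
  define A' where "A' = (\<Union>t\<in>carrier G - T. ?A t)"
  define R' where "R' = (\<Union>t\<in>carrier G - T. ?R t)"
  have T: "finite T" "T \<subseteq> carrier G" using T1 T2 by (auto simp: T_def)
  have tails: "(\<Union>t\<in>carrier G - S. ?A t) \<in> sets M" "(\<Union>t\<in>carrier G - S. ?R t) \<in> sets M" for S
    using A_sets R_sets countable_G by (auto intro!: sets.countable_UN')
  have A': "A' \<in> sets M" "measure M A' < \<delta>"
  proof -
    show "A' \<in> sets M" unfolding A'_def by (rule tails)
    have "A' \<subseteq> (\<Union>t\<in>carrier G - T1. ?A t)" by (auto simp: A'_def T_def)
    from M.finite_measure_mono[OF this tails(1)] show "measure M A' < \<delta>"
      using T1(3) by linarith
  qed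
  have R': "R' \<in> sets M" "measure M R' < \<delta>"
  proof -
    show "R' \<in> sets M" unfolding R'_def by (rule tails)
    have "R' \<subseteq> (\<Union>t\<in>carrier G - T2. ?R t)" by (auto simp: R'_def T_def)
    from M.finite_measure_mono[OF this tails(2)] show "measure M R' < \<delta>"
      using T2(3) by linarith
  qed
  define m where "m t = fibre_mean (\<lambda>\<gamma>. f \<gamma> * indicator (?A t) (rng \<G> \<gamma>))" for t
  have m_S: "m t \<in> group_S G" if "t \<in> carrier G" for t
    unfolding m_def using f A_sets[OF that] by (rule fibre_mean_in_group_S)
  define w where "w t = (\<lambda>s. m t s - m t (inv t \<otimes> s))" for t
  have w_S: "w t \<in> group_S G" if "t \<in> carrier G" for t
    unfolding w_def using m_S[OF that] group_S_translate[OF m_S[OF that] that] by (rule group_S_diff)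
  have w_0: "\<phi> (w t) = 0" if t: "t \<in> carrier G" for t
    unfolding w_def
    using group_state_linear(3)[OF \<phi> m_S[OF t] group_S_translate[OF m_S[OF t] t]] inv[OF t m_S[OF t]] by simp
  have sum_w: "(\<lambda>s. \<Sum>t\<in>T. w t s) \<in> group_S G"
    using T w_S by (intro group_S_sum) auto
  have "\<phi> (\<lambda>s. \<Sum>t\<in>S. w t s) = 0" if "finite S" "S \<subseteq> T" for S
    using that
  proof (induction S)
    case empty
    show ?case using group_state_linear(4)[OF \<phi> sum_w sum_w, of 0] by simp
  next
    case (insert t S)
    then have "t \<in> carrier G" "(\<lambda>s. \<Sum>t\<in>S. w t s) \<in> group_S G"
      using T w_S by (auto intro!: group_S_sum)
    then show ?case
      using insert group_state_linear(1)[OF \<phi> w_S] w_0 by simp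
  qed
  then have sum_w_0: "\<phi> (\<lambda>s. \<Sum>t\<in>T. w t s) = 0" using T by blast
  have "norm (fibre_mean ?u g - (\<Sum>t\<in>T. w t g)) \<le> \<epsilon>" if g: "g \<in> carrier G" for g
  proof -
    \<comment> \<open>\<open>a\<close> and \<open>b\<close> are the two terms of the function in question on the fibre over \<open>g\<close>; \<open>p t\<close> and \<open>q t\<close> are
      their restrictions to the slice \<open>t\<close>.\<close>
    define a where "a x = f (g, x) * indicator (rng \<G> -` (src \<G> ` \<theta>)) (g, x)" for x
    define b where "b x = left_translate \<G> \<theta> f (g, x)" for x
    define p where "p t x = f (g, x) * indicator (?A t) (\<alpha> g x)" for t x
    define q where "q t x = f (inv t \<otimes> g, x) * indicator (?R t) (\<alpha> g x)" for t x
    have ind_meas: "(\<lambda>x. indicator S (\<alpha> g x) :: complex) \<in> borel_measurable M" if "S \<in> sets M" for S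
      using measurable_compose[OF act_measurable[OF g] borel_measurable_indicator[OF that]] .
    have src: "indicator (rng \<G> -` (src \<G> ` \<theta>)) (g, x) = (indicator (\<Union>t\<in>carrier G. ?A t) (\<alpha> g x) :: complex)" for x
      by (simp add: source_image[OF \<theta>] indicator_def)
    have b_on: "b x = f (inv t \<otimes> g, x)" if "t \<in> carrier G" "\<alpha> g x \<in> ?R t" for t x
      unfolding b_def using left_translate_on_slice[OF \<theta> that] .
    have b_off: "b x = 0" if "\<alpha> g x \<notin> (\<Union>t\<in>carrier G. ?R t)" for x
      unfolding b_def using left_translate_off_slices[OF \<theta> that] .
    have a_tail: "a x - (\<Sum>t\<in>T. p t x) = a x * indicator A' (\<alpha> g x)" for x
      unfolding p_def A'_def using disjoint_source_slices[OF \<theta>] T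
      by (rule disjoint_family_partial_sum) (simp_all only: a_def src, auto simp: indicator_def)
    have b_tail: "b x - (\<Sum>t\<in>T. q t x) = b x * indicator R' (\<alpha> g x)" for x
      unfolding q_def R'_def using disjoint_range_slices[OF \<theta>] T b_on b_off
      by (rule disjoint_family_partial_sum)
    have a_meas: "a \<in> borel_measurable M"
      unfolding a_def[abs_def] src using f_meas[OF g] ind_meas[OF tails(1)[of "{}"]] by simp
    have b_meas: "b \<in> borel_measurable M"
    proof (rule measurable_countable_pieces[OF countable_G])
      show "{x \<in> space M. \<alpha> g x \<in> ?R t} \<in> sets M" if "t \<in> carrier G" for t
        using act_vimage_sets[OF g R_sets[OF that]] .
      show "(\<lambda>x. f (inv t \<otimes> g, x)) \<in> borel_measurable M" if "t \<in> carrier G" for t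
        using f_meas g that by simp
      show "b x = f (inv t \<otimes> g, x)" if "t \<in> carrier G" "x \<in> {x \<in> space M. \<alpha> g x \<in> ?R t}" for t x
        using b_on that by simp
      show "b x = 0" if "x \<in> space M" "x \<notin> (\<Union>t\<in>carrier G. {x \<in> space M. \<alpha> g x \<in> ?R t})" for x
        using b_off that by blast
    qed
    have f_all: "AE x in M. \<forall>t\<in>carrier G. norm (f (inv t \<otimes> g, x)) \<le> C"
      using C(2) g by (intro AE_ball_countable'[OF _ countable_G]) auto
    have a_bound: "AE x in M. norm (a x) \<le> C"
      using C(2)[OF g] by eventually_elim (auto simp: a_def indicator_def C(1))
    have b_bound: "AE x in M. norm (b x) \<le> C"
      using f_all
    proof eventually_elim
      case (elim x)
      show ?case
        using b_on[of _ x] b_off[of x] elim C(1) by (cases "\<alpha> g x \<in> (\<Union>t\<in>carrier G. ?R t)") auto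
    qed
    have a_int: "integrable M a" and b_int: "integrable M b"
      using M.integrable_const_bound a_bound a_meas b_bound b_meas by blast+
    have p_int: "integrable M (p t)" if t: "t \<in> carrier G" for t
    proof (rule M.integrable_const_bound)
      show "AE x in M. norm (p t x) \<le> C"
        using C(2)[OF g] by eventually_elim (auto simp: p_def indicator_def C(1))
      show "p t \<in> borel_measurable M"
        unfolding p_def[abs_def] using f_meas[OF g] ind_meas[OF A_sets[OF t]] by simp
    qed
    have q_int: "integrable M (q t)" if t: "t \<in> carrier G" for t
    proof (rule M.integrable_const_bound)
      have tg: "inv t \<otimes> g \<in> carrier G" using t g by simp
      show "AE x in M. norm (q t x) \<le> C"
        using C(2)[OF tg] by eventually_elim (auto simp: q_def indicator_def C(1))
      show "q t \<in> borel_measurable M"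
        unfolding q_def[abs_def] using f_meas[OF tg] ind_meas[OF R_sets[OF t]] by simp
    qed
    have w_eq: "w t g = (\<integral>x. p t x - q t x \<partial>M)" if t: "t \<in> carrier G" for t
    proof -
      have "f (inv t \<otimes> g, x) * indicator (?A t) (\<alpha> (inv t \<otimes> g) x) = q t x" if x: "x \<in> space M" for x
        using x t g by (simp add: q_def range_slice_def act_mult act_closed indicator_def)
      then have "m t (inv t \<otimes> g) = integral\<^sup>L M (q t)"
        unfolding m_def fibre_mean_def by (intro Bochner_Integration.integral_cong) auto
      then show ?thesis
        using p_int[OF t] q_int[OF t] by (simp add: w_def m_def fibre_mean_def p_def[abs_def])
    qed
    have "fibre_mean ?u g - (\<Sum>t\<in>T. w t g) =
        (\<integral>x. a x - b x \<partial>M) - (\<integral>x. (\<Sum>t\<in>T. p t x - q t x) \<partial>M)"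
    proof -
      have "(\<integral>x. (\<Sum>t\<in>T. p t x - q t x) \<partial>M) = (\<Sum>t\<in>T. (\<integral>x. p t x - q t x \<partial>M))"
        using p_int q_int T by (intro Bochner_Integration.integral_sum) auto
      also have "\<dots> = (\<Sum>t\<in>T. w t g)" using T w_eq by (intro sum.cong) auto
      finally show ?thesis by (simp add: fibre_mean_def a_def b_def)
    qed
    also have "\<dots> = (\<integral>x. (a x - b x) - (\<Sum>t\<in>T. p t x - q t x) \<partial>M)"
      using a_int b_int p_int q_int T
      by (intro Bochner_Integration.integral_diff[symmetric] Bochner_Integration.integrable_diff
          Bochner_Integration.integrable_sum) auto
    also have "\<dots> = (\<integral>x. a x * indicator A' (\<alpha> g x) - b x * indicator R' (\<alpha> g x) \<partial>M)"
      by (simp add: sum_subtractf a_tail[symmetric] b_tail[symmetric] algebra_simps)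
    finally have eq: "fibre_mean ?u g - (\<Sum>t\<in>T. w t g) =
        (\<integral>x. a x * indicator A' (\<alpha> g x) - b x * indicator R' (\<alpha> g x) \<partial>M)" .
    let ?A' = "{x \<in> space M. \<alpha> g x \<in> A'}" and ?R' = "{x \<in> space M. \<alpha> g x \<in> R'}"
    have sets: "?A' \<in> sets M" "?R' \<in> sets M" using A' R' g by (auto intro!: act_vimage_sets)
    let ?r = "\<lambda>x. a x * indicator A' (\<alpha> g x) - b x * indicator R' (\<alpha> g x)"
    have r_bound: "AE x in M. norm (?r x) \<le> C * (indicator ?A' x + indicator ?R' x)"
      using a_bound b_bound AE_space
    proof eventually_elim
      case (elim x)
      have "norm (?r x) \<le> norm (a x * indicator A' (\<alpha> g x)) + norm (b x * indicator R' (\<alpha> g x))"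
        by (rule norm_triangle_ineq4)
      also have "\<dots> \<le> C * indicator ?A' x + C * indicator ?R' x"
        using elim C(1) by (intro add_mono) (auto simp: indicator_def)
      finally show ?case by (simp add: distrib_left)
    qed
    have bound_int: "integrable M (\<lambda>x. C * (indicator ?A' x + indicator ?R' x))"
      using sets by (simp add: M.integrable_indicator_real)
    have r_meas: "?r \<in> borel_measurable M"
      using a_meas b_meas ind_meas[OF A'(1)] ind_meas[OF R'(1)] by simp
    have "norm (\<integral>x. ?r x \<partial>M) \<le> (\<integral>x. norm (?r x) \<partial>M)"
      by (rule integral_norm_bound)
    also have "\<dots> \<le> (\<integral>x. C * (indicator ?A' x + indicator ?R' x) \<partial>M)"
    proof (rule integral_mono_AE[OF _ bound_int r_bound])
      have "AE x in M. norm (?r x) \<le> norm (C * (indicator ?A' x + indicator ?R' x))"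
        using r_bound by eventually_elim auto
      then show "integrable M (\<lambda>x. norm (?r x))"
        using Bochner_Integration.integrable_bound[OF bound_int r_meas] by simp
    qed
    also have "\<dots> = C * (measure M A' + measure M R')"
      using sets measure_act_vimage[OF g] A' R' by (simp add: M.integrable_indicator_real)
    also have "\<dots> \<le> C * (\<delta> + \<delta>)"
      using A' R' C(1) by (intro mult_left_mono add_mono) auto
    finally show ?thesis using eq \<delta>(2) by simp
  qed
  then show "\<exists>w\<in>group_S G. \<phi> w = 0 \<and> (\<forall>s\<in>carrier G. norm (fibre_mean ?u s - w s) \<le> \<epsilon>)"
    using sum_w sum_w_0 by blast
qed

end


section \<open>Equivalence of the two notions of proper proximality\<close>

theorem theorem2:
  fixes G :: "('g, 'm) monoid_scheme" and M :: "'x measure" and \<alpha> :: "'g \<Rightarrow> 'x \<Rightarrow> 'x"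
  assumes "group G" and "countable (carrier G)"
    and "prob_space M" and "standard_borel M"
    and "pmp_action G M \<alpha>" and "essentially_free G M \<alpha>"
  shows "properly_proximal_group G \<longleftrightarrow> properly_proximal_groupoid (transformation_groupoid G M \<alpha>)"
proof -
  interpret countable_pmp_action G M \<alpha>
    by (rule countable_pmp_action.intro[OF assms(1,2,3,5)])
  have "\<not> properly_proximal_group G" if not_pp: "\<not> properly_proximal_groupoid \<G>"
  proof -
    obtain \<phi> where "left_invariant_state \<G> \<phi>"
      using not_pp unfolding properly_proximal_groupoid_def by blast
    then show ?thesis
      unfolding properly_proximal_group_def not_not
      by (intro exI[of _ "\<lambda>f. \<phi> (\<lambda>\<gamma>. f (fst \<gamma>))"] conjI ballI state_pullback_lift)
  qed
  moreover have "\<not> properly_proximal_groupoid \<G>" if not_pp: "\<not> properly_proximal_group G"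
  proof -
    obtain \<phi> where \<phi>: "state_on K (group_S G) \<phi>"
        "\<And>t f. t \<in> carrier G \<Longrightarrow> f \<in> group_S G \<Longrightarrow> \<phi> (\<lambda>s. f (inv\<^bsub>G\<^esub> t \<otimes>\<^bsub>G\<^esub> s)) = \<phi> f"
      using not_pp unfolding properly_proximal_group_def by blast
    have "left_invariant_state \<G> (\<lambda>f. \<phi> (fibre_mean f))"
      unfolding left_invariant_state_def arrow_measure
      by (intro conjI ballI fibre_mean_state[OF \<phi>(1)] fibre_mean_left_invariant[OF \<phi>])
    moreover have "normal_functional (units \<G>) (\<lambda>f. \<phi> (fibre_mean (\<lambda>\<gamma>. f (rng \<G> \<gamma>))))"
      using fibre_mean_normal[OF \<phi>(1)] by (simp only: groupoid_simps)
    ultimately show ?thesis unfolding properly_proximal_groupoid_def by blast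
  qed
  ultimately show ?thesis by blast
qed

end
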